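(* Let $U\subset C^1$ be open, let $f:U\to\mathbb{R}^n$ be $C^1_F$-smooth with property (e), let $\bar\phi\in X$ be a stationary point of the semiflow $\Sigma:\Omega\to X$ generated by $x'(t)=f(x_t)$ on $X=\{\phi\in U:\phi'(0)=f(\phi)\}$, and let $N$, $d$, $\beta$, $\gamma$, $V$ and the $C^1_F$-submanifold $W^s=V\cap R_{d,1}^{-1}(W^s_d)$ of $C^1$ be as described in the context. Then the following holds. (i) $W^s\subset X$, and $W^s$ is locally positively invariant. (ii) There are an open neighbourhood $\tilde V$ of $\bar\phi$ in $V$ with $[0,\infty)\times(\tilde V\cap W^s)\subset\Omega$ and a constant $\tilde c>0$ such that for all $\phi\in\tilde V\cap W^s$ the solution $x:\mathbb{R}\to\mathbb{R}^n$ on $[0,\infty)$ of $x'(t)=f(x_t)$ with $x_0=\phi$ satisfies $$|x(t)-\bar\phi(0)|+|x'(t)|\le\tilde c\,e^{-\gamma t}|R_{d,1}\phi-\bar\phi_d|_{d,1}\quad\text{for all }t\ge0.$$ (iii) There are an open neighbourhood $\hat V$ of $\bar\phi$ in $V$ and a constant $\hat c>0$ such that for every solution $x:\mathbb{R}\to\mathbb{R}^n$ on $[0,\infty)$ of $x'(t)=f(x_t)$ with $x_0\in\hat V\cap X$ and $$|x(t)-\bar\phi(0)|+|x'(t)|\le\hat c\,e^{-\beta t}\quad\text{for all }t\ge0$$ we have $x_0\in W^s$.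
   Context: Spaces. $C$, $C^1$ are the Fréchet spaces of continuous, respectively continuously differentiable, maps $(-\infty,0]\to\mathbb{R}^n$ with locally uniform convergence of maps, respectively of maps and derivatives. For $d>0$, $C_d$ and $C^1_d$ are the Banach spaces of continuous, respectively continuously differentiable, maps $[-d,0]\to\mathbb{R}^n$; $|\phi|_{d,1}=\max|\phi|+\max|\phi'|$. $R_{d,1}:C^1\to C^1_d$ is restriction to $[-d,0]$, and $P_{d,1}:C^1_d\to C^1$ is given by $(P_{d,1}\phi)(s)=\phi(s)$ on $[-d,0]$ and $(P_{d,1}\phi)(s)=\phi(-d)+(s+d)\phi'(-d)$ for $s<-d$. Segments are $x_t(s)=x(t+s)$, for $s\le0$ or for $s\in[-d,0]$ according to the space in which the equation is posed. A solution on an interval $I$ of $x'(t)=f(x_t)$ is a map $x$ defined on $(-\infty,0]+I$ with $x_t\in U$ for $t\in I$ which is differentiable on $I$ and satisfies the equation there; analogously, with $[-d,0]+I$, for equations posed in $C^1_d$. $C^1_F$-smoothness. For topological vector spaces $E,W$, $L_c(E,W)$ (continuous linear maps) carries the topology $\beta$ of uniform convergence on bounded sets. A continuous map $h:E\supset O\to W$, $O$ open, is $C^1_F$-smooth if all directional derivatives $Dh(u)v=\lim_{0\ne t\to0}\frac1t(h(u+tv)-h(u))$ exist, each $Dh(u)$ is linear and continuous, and $O\ni u\mapsto Dh(u)\in L_c(E,W)$ is $\beta$-continuous. A subset $M$ of a Fréchet space $F=G\oplus H$ ($G,H$ closed) is a $C^1_F$-submanifold if each $m\in M$ has an open neighbourhood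 $O$ in $F$ with an injective $C^1_F$-map $K$ of $O$ onto an open set $W\subset F$, with $C^1_F$-smooth inverse, such that $K(M\cap O)=W\cap G$; codimension is $\dim H$. $T_mM$ is the set of tangent vectors $c'(0)$ of continuously differentiable curves in $M$ through $c(0)=m$. Property (e) of $f$: each $Df(\phi):C^1\to\mathbb{R}^n$, $\phi\in U$, has a linear extension $D_ef(\phi):C\to\mathbb{R}^n$ such that $U\times C\ni(\phi,\chi)\mapsto D_ef(\phi)\chi\in\mathbb{R}^n$ is continuous. Semiflow. Under these hypotheses $X$ is a $C^1_F$-submanifold of $C^1$ of codimension $n$; for $\phi\in X$ let $x^\phi:(-\infty,t_\phi)\to\mathbb{R}^n$ be the maximal solution of $x'(t)=f(x_t)$ for $t>0$ with $x_0=\phi$; $\Omega=\{(t,\phi)\in[0,\infty)\times X:t<t_\phi\}$ and $\Sigma(t,\phi)=x^\phi_t$ define a continuous semiflow. $\bar\phi\in X$ is a stationary point if $\Sigma(t,\bar\phi)=\bar\phi$ for all $t\ge0$; then $\bar\phi$ is constant. Choice of $N$ and $d$. It is known that $f$ is of locally bounded delay; fix an open neighbourhood $N\subset U$ of $\bar\phi$ and $d>0$ such that $f(\chi)=f(\psi)$ for all $\chi,\psi\in N$ with $\chi=\psi$ on $[-d,0]$. Reduced equation. $\bar\phi_d=R_{d,1}\bar\phi$. Fix an open neighbourhood $U_d$ of $\bar\phi_d$ in $C^1_d$ with $P_{d,1}U_d\subset N$ and put $f_d:U_d\to\mathbb{R}^n$, $f_d(\phi)=f(P_{d,1}\phi)$.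 It is known that $f_d$ is $C^1_F$-smooth, that its derivatives have linear extensions $D_ef_d(\phi):C_d\to\mathbb{R}^n$ with $(\phi,\chi)\mapsto D_ef_d(\phi)\chi$ continuous on $U_d\times C_d$, and that $x'(t)=f_d(x_t)$ defines a continuous semiflow $\Sigma_d:\Omega_d\to X_d$ of maximal solutions on the submanifold $X_d=\{\phi\in U_d:\phi'(0)=f_d(\phi)\}$ of $C^1_d$, with stationary point $\bar\phi_d$. Let $C_d=C_{d,s}\oplus C_{d,c}\oplus C_{d,u}$ be the decomposition into the linear stable, center and unstable spaces of the strongly continuous semigroup on $C_d$ given by the solutions of $v'(t)=D_ef_d(\bar\phi_d)v_t$ (spectral subspaces for the parts of the spectrum of the generator with negative, zero, positive real part). Put $Y_{d,s}=C_{d,s}\cap T_{\bar\phi_d}X_d$. Local stable manifold of $\Sigma_d$. $W^s_d\subset X_d$ denotes the (known) local stable manifold of $\Sigma_d$ at $\bar\phi_d$: a continuously differentiable submanifold of $C^1_d$ containing $\bar\phi_d$, of codimension $n+\dim C_{d,c}+\dim C_{d,u}$, locally positively invariant under $\Sigma_d$, with $T_{\bar\phi_d}W^s_d=Y_{d,s}$, such that for some $\beta>0$ with $\mathrm{Re}\,z<-\beta<0$ for all $z$ with $\mathrm{Re}\,z<0$ in the spectrum of the generator of the semigroup on $C_d$, and for some $\gamma>\beta$: (I) there are an open neighbourhood $\tilde W^s_d$ of $\bar\phi_d$ in $W^s_d$ with $[0,\infty)\times\tilde W^s_d\subset\Omega_d$ and $\Sigma_d([0,\infty)\times\tilde W^s_d)\subset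 W^s_d$, and a constant $c>0$ with $|\Sigma_d(t,\psi)-\bar\phi_d|_{d,1}\le c\,e^{-\gamma t}|\psi-\bar\phi_d|_{d,1}$ for all $\psi\in\tilde W^s_d$, $t\ge0$; (II) there is a constant $\bar c>0$ such that each $\psi\in X_d$ with $[0,\infty)\times\{\psi\}\subset\Omega_d$ and $e^{\beta t}|\Sigma_d(t,\psi)-\bar\phi_d|_{d,1}<\bar c$ for all $t\ge0$ belongs to $W^s_d$. Definition of $W^s$. $V$ is an open neighbourhood of $\bar\phi$ in $N$ such that $W^s=V\cap R_{d,1}^{-1}(W^s_d)$ is a $C^1_F$-submanifold of $C^1$, of codimension $n+\dim C_{d,c}+\dim C_{d,u}$, with $T_{\bar\phi}W^s=R_{d,1}^{-1}(Y_{d,s})$ (such $V$ exists by transversality). Locally positively invariant: there is an open neighbourhood $V_\ast$ of the stationary point in the ambient space such that for every $(t,\phi)$ in the domain of the semiflow with $\phi$ in the submanifold and with the orbit piece $\{\text{semiflow}(s,\phi):0\le s\le t\}$ contained in $V_\ast$, this orbit piece is contained in the submanifold. *)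

theory Defs
  imports "HOL-Analysis.Analysis" "HOL-Library.Function_Algebras"
begin

section \<open>Functions as a real vector space\<close>

instantiation "fun" :: (type, real_vector) real_vector
begin

definition scaleR_fun :: "real \<Rightarrow> ('a \<Rightarrow> 'b) \<Rightarrow> 'a \<Rightarrow> 'b"
  where "scaleR_fun r f = (\<lambda>x. r *\<^sub>R f x)"

instance
  by standard (auto simp: scaleR_fun_def fun_eq_iff algebra_simps)

end

section \<open>Calculus in topological vector spaces\<close>

text \<open>
  A topological vector space is a \<^typ>\<open>'a topology\<close> on a vector space type whose
  \<^const>\<open>topspace\<close> is a linear subspace. (For function types this topology is unrelated to the
  type class instance of pointwise convergence.)
\<close>

text \<open>Elements of \<open>L_c(E,W)\<close> are normalised to vanish off the carrier of \<open>E\<close>.\<close>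

definition Lc :: "'a::real_vector topology \<Rightarrow> 'b::real_vector topology \<Rightarrow> ('a \<Rightarrow> 'b) set" where
  "Lc E W = {T. continuous_map E W T
      \<and> (\<forall>u\<in>topspace E. \<forall>v\<in>topspace E. T (u + v) = T u + T v)
      \<and> (\<forall>r. \<forall>v\<in>topspace E. T (r *\<^sub>R v) = r *\<^sub>R T v)
      \<and> (\<forall>v. v \<notin> topspace E \<longrightarrow> T v = 0)}"

definition tvs_bounded :: "'a::real_vector topology \<Rightarrow> 'a set \<Rightarrow> bool" where
  "tvs_bounded E B \<longleftrightarrow> B \<subseteq> topspace E \<and>
     (\<forall>N. openin E N \<and> 0 \<in> N \<longrightarrow> (\<exists>r>0. \<forall>s\<ge>r. B \<subseteq> (\<lambda>v. s *\<^sub>R v) ` N))"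

lemma tvs_bounded_Un: "tvs_bounded E A \<Longrightarrow> tvs_bounded E B \<Longrightarrow> tvs_bounded E (A \<union> B)"
  unfolding tvs_bounded_def
proof (intro conjI allI impI)
  fix N
  assume A: "A \<subseteq> topspace E \<and> (\<forall>N. openin E N \<and> 0 \<in> N \<longrightarrow> (\<exists>r>0. \<forall>s\<ge>r. A \<subseteq> (\<lambda>v. s *\<^sub>R v) ` N))"
    and B: "B \<subseteq> topspace E \<and> (\<forall>N. openin E N \<and> 0 \<in> N \<longrightarrow> (\<exists>r>0. \<forall>s\<ge>r. B \<subseteq> (\<lambda>v. s *\<^sub>R v) ` N))"
    and N: "openin E N \<and> 0 \<in> N"
  obtain r where r: "r > 0" "\<forall>s\<ge>r. A \<subseteq> (\<lambda>v. s *\<^sub>R v) ` N" using A N by blast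
  obtain r' where r': "r' > 0" "\<forall>s\<ge>r'. B \<subseteq> (\<lambda>v. s *\<^sub>R v) ` N" using B N by blast
  show "\<exists>r>0. \<forall>s\<ge>r. A \<union> B \<subseteq> (\<lambda>v. s *\<^sub>R v) ` N"
    using r r' by (intro exI[of _ "max r r'"]) auto
qed auto

definition beta_open :: "'a::real_vector topology \<Rightarrow> 'b::real_vector topology \<Rightarrow> ('a \<Rightarrow> 'b) set \<Rightarrow> bool" where
  "beta_open E W S \<longleftrightarrow> S \<subseteq> Lc E W \<and>
     (\<forall>T\<in>S. \<exists>B N. tvs_bounded E B \<and> openin W N \<and> 0 \<in> N \<and>
        {A \<in> Lc E W. \<forall>v\<in>B. A v - T v \<in> N} \<subseteq> S)"

text \<open>The topology \<open>\<beta>\<close> of uniform convergence on bounded sets.\<close>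

definition Lc_top :: "'a::real_vector topology \<Rightarrow> 'b::real_vector topology \<Rightarrow> ('a \<Rightarrow> 'b) topology" where
  "Lc_top E W = topology (beta_open E W)"

lemma openin_Lc_top: "openin (Lc_top E W) S \<longleftrightarrow> beta_open E W S"
proof -
  have "istopology (beta_open E W)"
    unfolding istopology_def
  proof (intro conjI allI impI)
    fix S T assume S: "beta_open E W S" and T: "beta_open E W T"
    show "beta_open E W (S \<inter> T)"
      unfolding beta_open_def
    proof (intro conjI ballI)
      show "S \<inter> T \<subseteq> Lc E W" using S by (auto simp: beta_open_def)
      fix R assume R: "R \<in> S \<inter> T"
      obtain B N where 1: "tvs_bounded E B" "openin W N" "0 \<in> N"
          "{A \<in> Lc E W. \<forall>v\<in>B. A v - R v \<in> N} \<subseteq> S"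
        using S R unfolding beta_open_def by blast
      obtain B' N' where 2: "tvs_bounded E B'" "openin W N'" "0 \<in> N'"
          "{A \<in> Lc E W. \<forall>v\<in>B'. A v - R v \<in> N'} \<subseteq> T"
        using T R unfolding beta_open_def by blast
      show "\<exists>B N. tvs_bounded E B \<and> openin W N \<and> 0 \<in> N \<and>
          {A \<in> Lc E W. \<forall>v\<in>B. A v - R v \<in> N} \<subseteq> S \<inter> T"
        using 1 2 by (intro exI[of _ "B \<union> B'"] exI[of _ "N \<inter> N'"]) (auto intro: tvs_bounded_Un)
    qed
  next
    fix \<K> assume K: "\<forall>S\<in>\<K>. beta_open E W S"
    show "beta_open E W (\<Union>\<K>)"
      unfolding beta_open_def
    proof (intro conjI ballI)
      show "\<Union>\<K> \<subseteq> Lc E W" using K by (auto simp: beta_open_def)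
      fix T assume "T \<in> \<Union>\<K>"
      then obtain S where S: "S \<in> \<K>" "T \<in> S" by blast
      then have "beta_open E W S" using K by blast
      then obtain B N where "tvs_bounded E B" "openin W N" "0 \<in> N"
          "{A \<in> Lc E W. \<forall>v\<in>B. A v - T v \<in> N} \<subseteq> S"
        using S(2) unfolding beta_open_def by blast
      then show "\<exists>B N. tvs_bounded E B \<and> openin W N \<and> 0 \<in> N \<and>
          {A \<in> Lc E W. \<forall>v\<in>B. A v - T v \<in> N} \<subseteq> \<Union>\<K>"
        using S(1) by blast
    qed
  qed
  then show ?thesis by (simp add: Lc_top_def)
qed

definition has_dir_deriv ::
    "'b::real_vector topology \<Rightarrow> ('a::real_vector \<Rightarrow> 'b) \<Rightarrow> 'a \<Rightarrow> 'a \<Rightarrow> 'b \<Rightarrow> bool" where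
  "has_dir_deriv W h u v l \<longleftrightarrow> limitin W (\<lambda>t::real. (1 / t) *\<^sub>R (h (u + t *\<^sub>R v) - h u)) l (at 0)"

definition C1F_smooth ::
    "'a::real_vector topology \<Rightarrow> 'b::real_vector topology \<Rightarrow> 'a set \<Rightarrow> ('a \<Rightarrow> 'b) \<Rightarrow> bool" where
  "C1F_smooth E W Q h \<longleftrightarrow> openin E Q \<and> continuous_map (subtopology E Q) W h \<and>
     (\<exists>D. (\<forall>u\<in>Q. D u \<in> Lc E W \<and> (\<forall>v\<in>topspace E. has_dir_deriv W h u v (D u v))) \<and>
          continuous_map (subtopology E Q) (Lc_top E W) D)"

text \<open>
  Submanifolds of finite codimension \<open>k\<close>. For Banach spaces \<^const>\<open>C1F_smooth\<close> means continuously
  differentiable in the usual sense, since \<open>\<beta>\<close> is then the topology of the operator norm.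
\<close>

definition C1F_submanifold :: "'a::real_vector topology \<Rightarrow> 'a set \<Rightarrow> nat \<Rightarrow> bool" where
  "C1F_submanifold F M k \<longleftrightarrow> M \<subseteq> topspace F \<and>
     (\<exists>G H. subspace G \<and> subspace H \<and> closedin F G \<and> closedin F H
        \<and> G \<inter> H = {0} \<and> {g + h | g h. g \<in> G \<and> h \<in> H} = topspace F
        \<and> (\<exists>B. finite B \<and> independent B \<and> span B = H \<and> card B = k)
        \<and> (\<forall>m\<in>M. \<exists>Q W K. openin F Q \<and> m \<in> Q \<and> openin F W
              \<and> inj_on K Q \<and> K ` Q = W
              \<and> C1F_smooth F F Q K \<and> C1F_smooth F F W (inv_into Q K)
              \<and> K ` (M \<inter> Q) = W \<inter> G))"

definition tangent_space :: "'a::real_vector topology \<Rightarrow> 'a set \<Rightarrow> 'a \<Rightarrow> 'a set" where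
  "tangent_space F M m = {c' (0::real) | c c'. \<exists>\<epsilon>>0. c 0 = m
      \<and> (\<forall>t\<in>{-\<epsilon><..<\<epsilon>}. c t \<in> M \<and> limitin F (\<lambda>h. (1 / h) *\<^sub>R (c (t + h) - c t)) (c' t) (at 0))
      \<and> continuous_map (top_of_set {-\<epsilon><..<\<epsilon>}) F c'}"

section \<open>Spectra of unbounded operators\<close>

text \<open>
  An operator is given by its graph \<open>A\<close>. The spectrum is that of the complexification: a pair
  \<open>(u, v)\<close> stands for \<open>u + i v\<close>.
\<close>

definition cscale :: "complex \<Rightarrow> 'a::real_vector \<times> 'a \<Rightarrow> 'a \<times> 'a" where
  "cscale z = (\<lambda>(u, v). (Re z *\<^sub>R u - Im z *\<^sub>R v, Im z *\<^sub>R u + Re z *\<^sub>R v))"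

definition complexify :: "('a \<times> 'a) set \<Rightarrow> (('a \<times> 'a) \<times> ('a \<times> 'a)) set" where
  "complexify A = {((u, v), (p, q)) | u v p q. (u, p) \<in> A \<and> (v, q) \<in> A}"

text \<open>\<open>R\<close> is the resolvent \<open>(z - A)\<^sup>-\<^sup>1\<close>.\<close>

definition resolvent_set :: "'a::real_vector topology \<Rightarrow> ('a \<times> 'a) set \<Rightarrow> complex set" where
  "resolvent_set E A = {z. \<exists>R. continuous_map (prod_topology E E) (prod_topology E E) R
      \<and> (\<forall>y\<in>topspace E \<times> topspace E. (R y, cscale z (R y) - y) \<in> complexify A)
      \<and> (\<forall>(x, w)\<in>complexify A. R (cscale z x - w) = x)}"

definition op_spectrum :: "'a::real_vector topology \<Rightarrow> ('a \<times> 'a) set \<Rightarrow> complex set" where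
  "op_spectrum E A = - resolvent_set E A"

definition op_part :: "('a \<times> 'a) set \<Rightarrow> 'a set \<Rightarrow> ('a \<times> 'a) set" where
  "op_part A M = A \<inter> M \<times> M"

definition generator ::
    "'a::real_vector topology \<Rightarrow> (real \<Rightarrow> 'a \<Rightarrow> 'a) \<Rightarrow> ('a \<times> 'a) set" where
  "generator E S = {(u, w). u \<in> topspace E \<and> limitin E (\<lambda>h. (1 / h) *\<^sub>R (S h u - u)) w (at_right 0)}"

text \<open>
  \<open>E = Es \<oplus> Ec \<oplus> Eu\<close> is the decomposition into the spectral subspaces of \<open>A\<close>: it reduces \<open>A\<close>, and
  the parts of \<open>A\<close> carry the parts of the spectrum in the open left half-plane, on the imaginary
  axis and in the open right half-plane. Finite-dimensionality of \<open>Ec\<close> and \<open>Eu\<close> makes the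
  decomposition unique; without it a subspace on which the part of \<open>A\<close> has empty spectrum
  (small solutions) could be assigned to any of the summands.
\<close>

definition spectral_decomposition ::
    "'a::real_vector topology \<Rightarrow> ('a \<times> 'a) set \<Rightarrow> 'a set \<Rightarrow> 'a set \<Rightarrow> 'a set \<Rightarrow> bool" where
  "spectral_decomposition E A Es Ec Eu \<longleftrightarrow>
     (\<forall>M\<in>{Es, Ec, Eu}. subspace M \<and> closedin E M)
     \<and> (\<forall>M\<in>{Ec, Eu}. \<exists>B. finite B \<and> span B = M)
     \<and> (\<forall>u\<in>topspace E. \<exists>!(a, b, c). a \<in> Es \<and> b \<in> Ec \<and> c \<in> Eu \<and> u = a + b + c)
     \<and> (\<forall>(u, w)\<in>A. \<exists>a a' b b' c c'. (a, a') \<in> op_part A Es \<and> (b, b') \<in> op_part A Ec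
           \<and> (c, c') \<in> op_part A Eu \<and> u = a + b + c \<and> w = a' + b' + c')
     \<and> op_spectrum (subtopology E Es) (op_part A Es) = {z \<in> op_spectrum E A. Re z < 0}
     \<and> op_spectrum (subtopology E Ec) (op_part A Ec) = {z \<in> op_spectrum E A. Re z = 0}
     \<and> op_spectrum (subtopology E Eu) (op_part A Eu) = {z \<in> op_spectrum E A. Re z > 0}"

section \<open>The spaces of histories\<close>

text \<open>
  \<open>J\<close> is the history interval: \<open>{..0}\<close> for \<open>C\<close>, \<open>C\<^sup>1\<close>, and \<open>{-d..0}\<close> for \<open>C\<^sub>d\<close>, \<open>C\<^sup>1\<^sub>d\<close>.
  A map on \<open>J\<close> is represented by its extension by \<open>0\<close> to the whole line.
\<close>

definition hderiv :: "real set \<Rightarrow> (real \<Rightarrow> real^'n) \<Rightarrow> real \<Rightarrow> real^'n" where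
  "hderiv J \<phi> s = vector_derivative \<phi> (at s within J)"

definition Cont :: "real set \<Rightarrow> (real \<Rightarrow> real^'n) set" where
  "Cont J = {\<phi>. continuous_on J \<phi> \<and> (\<forall>s. s \<notin> J \<longrightarrow> \<phi> s = 0)}"

definition C1 :: "real set \<Rightarrow> (real \<Rightarrow> real^'n) set" where
  "C1 J = {\<phi> \<in> Cont J. (\<forall>s\<in>J. \<phi> differentiable (at s within J)) \<and> continuous_on J (hderiv J \<phi>)}"

text \<open>
  The topologies of uniform convergence on compact subsets of \<open>J\<close>, of maps and of maps together
  with their derivatives; for \<open>J = {-d..0}\<close> these are the norm topologies of \<open>C\<^sub>d\<close> and \<open>C\<^sup>1\<^sub>d\<close>.
\<close>

definition Cont_open :: "real set \<Rightarrow> (real \<Rightarrow> real^'n) set \<Rightarrow> bool" where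
  "Cont_open J S \<longleftrightarrow> S \<subseteq> Cont J \<and>
     (\<forall>\<phi>\<in>S. \<exists>K \<epsilon>. compact K \<and> K \<subseteq> J \<and> \<epsilon> > 0 \<and>
        {\<psi> \<in> Cont J. \<forall>s\<in>K. norm (\<psi> s - \<phi> s) < \<epsilon>} \<subseteq> S)"

definition C1_open :: "real set \<Rightarrow> (real \<Rightarrow> real^'n) set \<Rightarrow> bool" where
  "C1_open J S \<longleftrightarrow> S \<subseteq> C1 J \<and>
     (\<forall>\<phi>\<in>S. \<exists>K \<epsilon>. compact K \<and> K \<subseteq> J \<and> \<epsilon> > 0 \<and>
        {\<psi> \<in> C1 J. \<forall>s\<in>K. norm (\<psi> s - \<phi> s) < \<epsilon> \<and> norm (hderiv J \<psi> s - hderiv J \<phi> s) < \<epsilon>} \<subseteq> S)"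

definition Cont_top :: "real set \<Rightarrow> (real \<Rightarrow> real^'n) topology" where
  "Cont_top J = topology (Cont_open J)"

definition C1_top :: "real set \<Rightarrow> (real \<Rightarrow> real^'n) topology" where
  "C1_top J = topology (C1_open J)"

lemma openin_Cont_top:
  fixes S :: "(real \<Rightarrow> real^'n) set"
  shows "openin (Cont_top J) S \<longleftrightarrow> Cont_open J S"
proof -
  have "istopology (Cont_open J :: (real \<Rightarrow> real^'n) set \<Rightarrow> bool)"
    unfolding istopology_def
  proof (intro conjI allI impI)
    fix S T :: "(real \<Rightarrow> real^'n) set" assume S: "Cont_open J S" and T: "Cont_open J T"
    show "Cont_open J (S \<inter> T)"
      unfolding Cont_open_def
    proof (intro conjI ballI)
      show "S \<inter> T \<subseteq> Cont J" using S by (auto simp: Cont_open_def)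
      fix \<phi> assume p: "\<phi> \<in> S \<inter> T"
      obtain K \<epsilon> where 1: "compact K" "K \<subseteq> J" "\<epsilon> > 0"
          "{\<psi> \<in> Cont J. \<forall>s\<in>K. norm (\<psi> s - \<phi> s) < \<epsilon>} \<subseteq> S"
        using S p unfolding Cont_open_def by blast
      obtain K' \<epsilon>' where 2: "compact K'" "K' \<subseteq> J" "\<epsilon>' > 0"
          "{\<psi> \<in> Cont J. \<forall>s\<in>K'. norm (\<psi> s - \<phi> s) < \<epsilon>'} \<subseteq> T"
        using T p unfolding Cont_open_def by blast
      show "\<exists>K \<epsilon>. compact K \<and> K \<subseteq> J \<and> \<epsilon> > 0 \<and>
          {\<psi> \<in> Cont J. \<forall>s\<in>K. norm (\<psi> s - \<phi> s) < \<epsilon>} \<subseteq> S \<inter> T"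
        using 1 2 by (intro exI[of _ "K \<union> K'"] exI[of _ "min \<epsilon> \<epsilon>'"]) auto
    qed
  next
    fix \<K> :: "(real \<Rightarrow> real^'n) set set" assume "\<forall>S\<in>\<K>. Cont_open J S"
    then show "Cont_open J (\<Union>\<K>)" unfolding Cont_open_def by (meson Sup_least Sup_upper UnionE order_trans)
  qed
  then show ?thesis by (simp add: Cont_top_def)
qed

lemma openin_C1_top:
  fixes S :: "(real \<Rightarrow> real^'n) set"
  shows "openin (C1_top J) S \<longleftrightarrow> C1_open J S"
proof -
  have "istopology (C1_open J :: (real \<Rightarrow> real^'n) set \<Rightarrow> bool)"
    unfolding istopology_def
  proof (intro conjI allI impI)
    fix S T :: "(real \<Rightarrow> real^'n) set" assume S: "C1_open J S" and T: "C1_open J T"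
    show "C1_open J (S \<inter> T)"
      unfolding C1_open_def
    proof (intro conjI ballI)
      show "S \<inter> T \<subseteq> C1 J" using S by (auto simp: C1_open_def)
      fix \<phi> assume p: "\<phi> \<in> S \<inter> T"
      obtain K \<epsilon> where 1: "compact K" "K \<subseteq> J" "\<epsilon> > 0"
          "{\<psi> \<in> C1 J. \<forall>s\<in>K. norm (\<psi> s - \<phi> s) < \<epsilon> \<and> norm (hderiv J \<psi> s - hderiv J \<phi> s) < \<epsilon>} \<subseteq> S"
        using S p unfolding C1_open_def by blast
      obtain K' \<epsilon>' where 2: "compact K'" "K' \<subseteq> J" "\<epsilon>' > 0"
          "{\<psi> \<in> C1 J. \<forall>s\<in>K'. norm (\<psi> s - \<phi> s) < \<epsilon>' \<and> norm (hderiv J \<psi> s - hderiv J \<phi> s) < \<epsilon>'} \<subseteq> T"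
        using T p unfolding C1_open_def by blast
      show "\<exists>K \<epsilon>. compact K \<and> K \<subseteq> J \<and> \<epsilon> > 0 \<and>
          {\<psi> \<in> C1 J. \<forall>s\<in>K. norm (\<psi> s - \<phi> s) < \<epsilon> \<and> norm (hderiv J \<psi> s - hderiv J \<phi> s) < \<epsilon>} \<subseteq> S \<inter> T"
        using 1 2 by (intro exI[of _ "K \<union> K'"] exI[of _ "min \<epsilon> \<epsilon>'"]) auto
    qed
  next
    fix \<K> :: "(real \<Rightarrow> real^'n) set set" assume "\<forall>S\<in>\<K>. C1_open J S"
    then show "C1_open J (\<Union>\<K>)" unfolding C1_open_def by (meson Sup_least Sup_upper UnionE order_trans)
  qed
  then show ?thesis by (simp add: C1_top_def)
qed

lemma topspace_Cont_top [simp]: "topspace (Cont_top J) = Cont J"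
proof -
  have "Cont_open J (Cont J)" by (force simp: Cont_open_def intro: exI[of _ "{}"] exI[of _ 1])
  then show ?thesis
    by (metis Cont_open_def openin_Cont_top openin_subset openin_topspace subset_antisym)
qed

lemma topspace_C1_top [simp]: "topspace (C1_top J) = C1 J"
proof -
  have "C1_open J (C1 J)" by (force simp: C1_open_def intro: exI[of _ "{}"] exI[of _ 1])
  then show ?thesis
    by (metis C1_open_def openin_C1_top openin_subset openin_topspace subset_antisym)
qed

definition norm_d1 :: "real \<Rightarrow> (real \<Rightarrow> real^'n) \<Rightarrow> real" where
  "norm_d1 d \<phi> = (SUP s\<in>{-d..0}. norm (\<phi> s)) + (SUP s\<in>{-d..0}. norm (hderiv {-d..0} \<phi> s))"

lemma hderiv_diff:
  assumes "d > 0" "\<phi> \<in> C1 {-d..0}" "\<psi> \<in> C1 {-d..0}" "s \<in> {-d..0}"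
  shows "((\<psi> - \<phi>) has_vector_derivative (hderiv {-d..0} \<psi> s - hderiv {-d..0} \<phi> s)) (at s within {-d..0})"
    and "hderiv {-d..0} (\<psi> - \<phi>) s = hderiv {-d..0} \<psi> s - hderiv {-d..0} \<phi> s"
proof -
  have "(\<psi> has_vector_derivative hderiv {-d..0} \<psi> s) (at s within {-d..0})"
    and "(\<phi> has_vector_derivative hderiv {-d..0} \<phi> s) (at s within {-d..0})"
    using assms by (simp_all add: C1_def hderiv_def flip: vector_derivative_works)
  then have "((\<lambda>s. \<psi> s - \<phi> s) has_vector_derivative (hderiv {-d..0} \<psi> s - hderiv {-d..0} \<phi> s))
      (at s within {-d..0})"
    by (rule has_vector_derivative_diff)
  then show *: "((\<psi> - \<phi>) has_vector_derivative (hderiv {-d..0} \<psi> s - hderiv {-d..0} \<phi> s)) (at s within {-d..0})"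
    by (simp add: fun_diff_def)
  show "hderiv {-d..0} (\<psi> - \<phi>) s = hderiv {-d..0} \<psi> s - hderiv {-d..0} \<phi> s"
    unfolding hderiv_def[of _ "\<psi> - \<phi>"]
    using vector_derivative_within_cbox[of "-d" 0 s "\<psi> - \<phi>"] assms * by (simp add: cbox_interval)
qed

lemma openin_C1_top_iff_norm_d1:
  assumes d: "d > 0"
  shows "openin (C1_top {-d..0}) S \<longleftrightarrow> S \<subseteq> C1 {-d..0} \<and>
    (\<forall>\<phi>\<in>S. \<exists>\<epsilon>>0. \<forall>\<psi>\<in>C1 {-d..0}. norm_d1 d (\<psi> - \<phi>) < \<epsilon> \<longrightarrow> \<psi> \<in> S)"
proof -
  let ?J = "{-d..0}"
  have cont: "continuous_on ?J (\<psi> - \<phi>)" "continuous_on ?J (hderiv ?J (\<psi> - \<phi>))"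
    if "\<phi> \<in> C1 ?J" "\<psi> \<in> C1 ?J" for \<phi> \<psi> :: "real \<Rightarrow> real^'n"
  proof -
    show "continuous_on ?J (\<psi> - \<phi>)"
      using that unfolding fun_diff_def by (intro continuous_on_diff) (auto simp: C1_def Cont_def)
    have "continuous_on ?J (\<lambda>s. hderiv ?J \<psi> s - hderiv ?J \<phi> s)"
      using that by (intro continuous_on_diff) (auto simp: C1_def)
    then show "continuous_on ?J (hderiv ?J (\<psi> - \<phi>))"
      by (rule continuous_on_eq) (simp add: hderiv_diff(2)[OF d that])
  qed
  have bdd: "bdd_above ((\<lambda>s. norm (g s)) ` ?J)" if "continuous_on ?J g" for g :: "real \<Rightarrow> real^'n"
    using that by (intro bounded_imp_bdd_above compact_imp_bounded compact_continuous_image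
        continuous_on_norm) auto
  have le: "norm (\<psi> s - \<phi> s) \<le> norm_d1 d (\<psi> - \<phi>)"
       "norm (hderiv ?J \<psi> s - hderiv ?J \<phi> s) \<le> norm_d1 d (\<psi> - \<phi>)"
    if "\<phi> \<in> C1 ?J" "\<psi> \<in> C1 ?J" "s \<in> ?J" for \<phi> \<psi> :: "real \<Rightarrow> real^'n" and s
  proof -
    have "norm ((\<psi> - \<phi>) s) \<le> (SUP s\<in>?J. norm ((\<psi> - \<phi>) s))"
         "norm (hderiv ?J (\<psi> - \<phi>) s) \<le> (SUP s\<in>?J. norm (hderiv ?J (\<psi> - \<phi>) s))"
      using bdd[OF cont(1)[OF that(1,2)]] bdd[OF cont(2)[OF that(1,2)]] that(3)
      by (auto intro!: cSUP_upper)
    moreover have "0 \<le> norm ((\<psi> - \<phi>) s)" "0 \<le> norm (hderiv ?J (\<psi> - \<phi>) s)" by auto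
    ultimately have "norm ((\<psi> - \<phi>) s) \<le> norm_d1 d (\<psi> - \<phi>)"
        "norm (hderiv ?J (\<psi> - \<phi>) s) \<le> norm_d1 d (\<psi> - \<phi>)"
      unfolding norm_d1_def by linarith+
    then show "norm (\<psi> s - \<phi> s) \<le> norm_d1 d (\<psi> - \<phi>)"
       "norm (hderiv ?J \<psi> s - hderiv ?J \<phi> s) \<le> norm_d1 d (\<psi> - \<phi>)"
      by (simp_all add: hderiv_diff(2)[OF d that])
  qed
  have ge: "norm_d1 d (\<psi> - \<phi>) \<le> 2 * e"
    if "\<phi> \<in> C1 ?J" "\<psi> \<in> C1 ?J"
      "\<forall>s\<in>?J. norm (\<psi> s - \<phi> s) < e \<and> norm (hderiv ?J \<psi> s - hderiv ?J \<phi> s) < e"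
    for \<phi> \<psi> :: "real \<Rightarrow> real^'n" and e
  proof -
    have "(SUP s\<in>?J. norm ((\<psi> - \<phi>) s)) \<le> e" "(SUP s\<in>?J. norm (hderiv ?J (\<psi> - \<phi>) s)) \<le> e"
      using d that by (auto intro!: cSUP_least simp: hderiv_diff(2)[OF d that(1,2)] intro: less_imp_le)
    then show ?thesis unfolding norm_d1_def by linarith
  qed
  show ?thesis
    unfolding openin_C1_top C1_open_def
  proof (intro conj_cong refl ball_cong iffI)
    fix \<phi> assume S: "S \<subseteq> C1 ?J" and p: "\<phi> \<in> S"
    assume "\<exists>K \<epsilon>. compact K \<and> K \<subseteq> ?J \<and> \<epsilon> > 0 \<and>
      {\<psi> \<in> C1 ?J. \<forall>s\<in>K. norm (\<psi> s - \<phi> s) < \<epsilon> \<and> norm (hderiv ?J \<psi> s - hderiv ?J \<phi> s) < \<epsilon>} \<subseteq> S"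
    then obtain K e where K: "K \<subseteq> ?J" "e > 0"
      "{\<psi> \<in> C1 ?J. \<forall>s\<in>K. norm (\<psi> s - \<phi> s) < e \<and> norm (hderiv ?J \<psi> s - hderiv ?J \<phi> s) < e} \<subseteq> S"
      by blast
    have "\<psi> \<in> S" if "\<psi> \<in> C1 ?J" "norm_d1 d (\<psi> - \<phi>) < e" for \<psi>
    proof -
      have "norm (\<psi> s - \<phi> s) < e \<and> norm (hderiv ?J \<psi> s - hderiv ?J \<phi> s) < e" if "s \<in> K" for s
        using le[of \<phi> \<psi> s] that K(1) S p \<open>\<psi> \<in> C1 ?J\<close> \<open>norm_d1 d (\<psi> - \<phi>) < e\<close>
        by (meson le_less_trans subsetD)
      then show ?thesis using K(3) that(1) by blast
    qed
    then show "\<exists>\<epsilon>>0. \<forall>\<psi>\<in>C1 ?J. norm_d1 d (\<psi> - \<phi>) < \<epsilon> \<longrightarrow> \<psi> \<in> S" using K(2) by blast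
  next
    fix \<phi> assume S: "S \<subseteq> C1 ?J" and p: "\<phi> \<in> S"
    assume "\<exists>\<epsilon>>0. \<forall>\<psi>\<in>C1 ?J. norm_d1 d (\<psi> - \<phi>) < \<epsilon> \<longrightarrow> \<psi> \<in> S"
    then obtain e where e: "e > 0" "\<And>\<psi>. \<psi> \<in> C1 ?J \<Longrightarrow> norm_d1 d (\<psi> - \<phi>) < e \<Longrightarrow> \<psi> \<in> S" by blast
    have "{\<psi> \<in> C1 ?J. \<forall>s\<in>?J. norm (\<psi> s - \<phi> s) < e / 3 \<and>
        norm (hderiv ?J \<psi> s - hderiv ?J \<phi> s) < e / 3} \<subseteq> S"
    proof clarify
      fix \<psi> assume "\<psi> \<in> C1 ?J" "\<forall>s\<in>?J. norm (\<psi> s - \<phi> s) < e / 3 \<and>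
        norm (hderiv ?J \<psi> s - hderiv ?J \<phi> s) < e / 3"
      then show "\<psi> \<in> S" using ge[of \<phi> \<psi> "e / 3"] e S p by fastforce
    qed
    then show "\<exists>K \<epsilon>. compact K \<and> K \<subseteq> ?J \<and> \<epsilon> > 0 \<and>
      {\<psi> \<in> C1 ?J. \<forall>s\<in>K. norm (\<psi> s - \<phi> s) < \<epsilon> \<and> norm (hderiv ?J \<psi> s - hderiv ?J \<phi> s) < \<epsilon>} \<subseteq> S"
      using e(1) by (intro exI[of _ ?J] exI[of _ "e / 3"]) auto
  qed
qed

definition restr :: "real \<Rightarrow> (real \<Rightarrow> real^'n) \<Rightarrow> real \<Rightarrow> real^'n" where
  "restr d \<phi> = (\<lambda>s. if s \<in> {-d..0} then \<phi> s else 0)"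

definition extend :: "real \<Rightarrow> (real \<Rightarrow> real^'n) \<Rightarrow> real \<Rightarrow> real^'n" where
  "extend d \<phi> = (\<lambda>s. if s \<in> {-d..0} then \<phi> s
      else if s < -d then \<phi> (-d) + (s + d) *\<^sub>R hderiv {-d..0} \<phi> (-d) else 0)"

section \<open>Delay differential equations\<close>

text \<open>\<open>De \<phi>\<close>, for \<open>\<phi> \<in> U\<close>, is a linear extension of the derivative \<open>Df(\<phi>)\<close> to all continuous maps,
  and \<open>(\<phi>, \<xi>) \<mapsto> De \<phi> \<xi>\<close> is continuous.\<close>

definition extended_derivative ::
    "real set \<Rightarrow> (real \<Rightarrow> real^'n) set \<Rightarrow> ((real \<Rightarrow> real^'n) \<Rightarrow> real^'n)
      \<Rightarrow> ((real \<Rightarrow> real^'n) \<Rightarrow> (real \<Rightarrow> real^'n) \<Rightarrow> real^'n) \<Rightarrow> bool" where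
  "extended_derivative J U f De \<longleftrightarrow>
     (\<forall>\<phi>\<in>U. (\<forall>\<xi>\<in>Cont J. \<forall>\<psi>\<in>Cont J. De \<phi> (\<xi> + \<psi>) = De \<phi> \<xi> + De \<phi> \<psi>)
        \<and> (\<forall>r. \<forall>\<xi>\<in>Cont J. De \<phi> (r *\<^sub>R \<xi>) = r *\<^sub>R De \<phi> \<xi>)
        \<and> (\<forall>\<xi>\<in>C1 J. has_dir_deriv euclidean f \<phi> \<xi> (De \<phi> \<xi>)))
     \<and> continuous_map (prod_topology (subtopology (C1_top J) U) (Cont_top J)) euclidean
         (\<lambda>(\<phi>, \<xi>). De \<phi> \<xi>)"

definition property_e ::
    "real set \<Rightarrow> (real \<Rightarrow> real^'n) set \<Rightarrow> ((real \<Rightarrow> real^'n) \<Rightarrow> real^'n) \<Rightarrow> bool" where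
  "property_e J U f \<longleftrightarrow> (\<exists>De. extended_derivative J U f De)"

definition segment :: "real set \<Rightarrow> (real \<Rightarrow> real^'n) \<Rightarrow> real \<Rightarrow> real \<Rightarrow> real^'n" where
  "segment J x t = (\<lambda>s. if s \<in> J then x (t + s) else 0)"

text \<open>Solutions of \<open>x'(t) = f(x\<^sub>t)\<close> on \<open>I\<close>; only the values of \<open>x\<close> on \<open>J + I\<close> matter.\<close>

definition solution_on ::
    "real set \<Rightarrow> (real \<Rightarrow> real^'n) set \<Rightarrow> ((real \<Rightarrow> real^'n) \<Rightarrow> real^'n) \<Rightarrow> real set
      \<Rightarrow> (real \<Rightarrow> real^'n) \<Rightarrow> bool" where
  "solution_on J U f I x \<longleftrightarrow> (\<forall>t\<in>I. segment J x t \<in> U \<and>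
     (x has_vector_derivative f (segment J x t)) (at t within {s + t' | s t'. s \<in> J \<and> t' \<in> I}))"

definition ivp_solution ::
    "real set \<Rightarrow> (real \<Rightarrow> real^'n) set \<Rightarrow> ((real \<Rightarrow> real^'n) \<Rightarrow> real^'n) \<Rightarrow> (real \<Rightarrow> real^'n)
      \<Rightarrow> ereal \<Rightarrow> (real \<Rightarrow> real^'n) \<Rightarrow> bool" where
  "ivp_solution J U f \<phi> T x \<longleftrightarrow> 0 < T \<and> segment J x 0 = \<phi>
     \<and> solution_on J U f {t. 0 < t \<and> ereal t < T} x"

text \<open>The maximal solution \<open>x\<^sup>\<phi>\<close> is the union of all solutions with initial value \<open>\<phi>\<close>, which agree
  on common intervals of existence.\<close>

definition t_max ::
    "real set \<Rightarrow> (real \<Rightarrow> real^'n) set \<Rightarrow> ((real \<Rightarrow> real^'n) \<Rightarrow> real^'n) \<Rightarrow> (real \<Rightarrow> real^'n) \<Rightarrow> ereal" where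
  "t_max J U f \<phi> = Sup {T. \<exists>x. ivp_solution J U f \<phi> T x}"

definition max_solution ::
    "real set \<Rightarrow> (real \<Rightarrow> real^'n) set \<Rightarrow> ((real \<Rightarrow> real^'n) \<Rightarrow> real^'n) \<Rightarrow> (real \<Rightarrow> real^'n)
      \<Rightarrow> real \<Rightarrow> real^'n" where
  "max_solution J U f \<phi> t = (THE y. \<exists>T x. ereal t < T \<and> ivp_solution J U f \<phi> T x \<and> y = x t)"

definition semiflow ::
    "real set \<Rightarrow> (real \<Rightarrow> real^'n) set \<Rightarrow> ((real \<Rightarrow> real^'n) \<Rightarrow> real^'n) \<Rightarrow> real
      \<Rightarrow> (real \<Rightarrow> real^'n) \<Rightarrow> real \<Rightarrow> real^'n" where
  "semiflow J U f t \<phi> = segment J (max_solution J U f \<phi>) t"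

definition solution_manifold ::
    "real set \<Rightarrow> (real \<Rightarrow> real^'n) set \<Rightarrow> ((real \<Rightarrow> real^'n) \<Rightarrow> real^'n) \<Rightarrow> (real \<Rightarrow> real^'n) set" where
  "solution_manifold J U f = {\<phi> \<in> U. hderiv J \<phi> 0 = f \<phi>}"

definition semiflow_domain ::
    "real set \<Rightarrow> (real \<Rightarrow> real^'n) set \<Rightarrow> ((real \<Rightarrow> real^'n) \<Rightarrow> real^'n)
      \<Rightarrow> (real \<times> (real \<Rightarrow> real^'n)) set" where
  "semiflow_domain J U f =
     {(t, \<phi>). 0 \<le> t \<and> \<phi> \<in> solution_manifold J U f \<and> ereal t < t_max J U f \<phi>}"

definition stationary_point :: "(real \<times> 'a) set \<Rightarrow> (real \<Rightarrow> 'a \<Rightarrow> 'a) \<Rightarrow> 'a \<Rightarrow> bool" where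
  "stationary_point \<Omega> \<Sigma> p \<longleftrightarrow> (\<forall>t\<ge>0. (t, p) \<in> \<Omega> \<and> \<Sigma> t p = p)"

definition locally_positively_invariant ::
    "'a topology \<Rightarrow> (real \<times> 'a) set \<Rightarrow> (real \<Rightarrow> 'a \<Rightarrow> 'a) \<Rightarrow> 'a \<Rightarrow> 'a set \<Rightarrow> bool" where
  "locally_positively_invariant E \<Omega> \<Sigma> p M \<longleftrightarrow>
     (\<exists>V. openin E V \<and> p \<in> V \<and>
        (\<forall>(t, u)\<in>\<Omega>. u \<in> M \<and> (\<forall>s\<in>{0..t}. \<Sigma> s u \<in> V) \<longrightarrow> (\<forall>s\<in>{0..t}. \<Sigma> s u \<in> M)))"

text \<open>The semigroup on \<open>C\<^sub>d\<close> of the linear equation \<open>v'(t) = L v\<^sub>t\<close>, posed on all of \<open>C\<^sub>d\<close>.\<close>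

definition linear_semigroup ::
    "real \<Rightarrow> ((real \<Rightarrow> real^'n) \<Rightarrow> real^'n) \<Rightarrow> real \<Rightarrow> (real \<Rightarrow> real^'n) \<Rightarrow> real \<Rightarrow> real^'n" where
  "linear_semigroup d L = semiflow {-d..0} (Cont {-d..0}) L"

end

theory Submission
  imports Defs
begin

text \<open>
  While a segment stays in \<open>N\<close> and its restriction to \<open>[-d,0]\<close> stays in \<open>U\<^sub>d\<close>, both equations have the
  same right-hand side, so that solutions of one are solutions of the other and, by uniqueness,
  restriction intertwines the semiflows. This gives (i). For (ii) and (iii) the solution has to be
  kept in \<open>N\<close>, although only its restrictions to \<open>[-d,0]\<close> are controlled. Neighbourhoods of \<open>\<phi>b\<close> in
  \<open>C\<^sup>1\<close> constrain maps on some \<open>[-k,0]\<close> only, and \<open>\<phi>b\<close> is constant; hence \<open>x\<^sub>t\<close> is close to \<open>\<phi>b\<close> as soon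
  as \<open>x\<^sub>0\<close> is close to it on \<open>[-k,0]\<close> and \<open>x\<close>, \<open>x'\<close> are close to \<open>\<phi>b 0\<close>, \<open>0\<close> on \<open>[0,\<infinity>)\<close>. The latter is the
  exponential estimate.
\<close>

section \<open>Spaces of continuously differentiable histories\<close>

text \<open>The semiflows are defined through \<open>THE\<close>, so nothing can be said about them
  before uniqueness, and uniqueness is where property (e) enters. A Lipschitz estimate of
  \<open>f\<close> in the norm of C1 would bound x' - y' by a multiple of itself, with no small
  factor to gain. The derivative extended to C gives an estimate by x - y alone, which integration
  over a short interval makes contractive.

  In (ii) staying in \<open>N\<close> and being a solution are not circular. The reduced solution
  exists for all times and decays by (I). Glued to the history, it is a continuously differentiable
  curve whose segments the decay puts into \<open>N\<close>; only then is it recognised as a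
  solution.

  In (iii) the norm on [-d,0] of the segment at time t sees x on [t-d,t], where the bound is weaker
  than at t by a factor up to exp (\<beta> * d). For t < d this window reaches into the initial
  history, which therefore has to be close to the stationary point on all of [-d,0]. Both effects
  are absorbed by the size of the neighbourhood and the constant.\<close>

definition C1_ball :: "real set \<Rightarrow> real set \<Rightarrow> real \<Rightarrow> (real \<Rightarrow> real^'n) \<Rightarrow> (real \<Rightarrow> real^'n) set" where
  "C1_ball J K \<epsilon> \<phi> =
     {\<psi> \<in> C1 J. \<forall>s\<in>K. norm (\<psi> s - \<phi> s) < \<epsilon> \<and> norm (hderiv J \<psi> s - hderiv J \<phi> s) < \<epsilon>}"

lemma C1_imp_has_vector_derivative:
  "\<phi> \<in> C1 J \<Longrightarrow> s \<in> J \<Longrightarrow> (\<phi> has_vector_derivative hderiv J \<phi> s) (at s within J)"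
  by (simp add: C1_def hderiv_def flip: vector_derivative_works)

lemma C1_continuous_on: "\<phi> \<in> C1 J \<Longrightarrow> continuous_on J \<phi>" "\<phi> \<in> C1 J \<Longrightarrow> continuous_on J (hderiv J \<phi>)"
  by (auto simp: C1_def Cont_def)

text \<open>The inequalities that define \<open>C1_ball\<close> are strict at each single argument.
  Compactness turns them into a uniform margin, which is what makes the balls open.\<close>

lemma compact_norm_less_gap:
  fixes g :: "real \<Rightarrow> real^'n"
  assumes "compact K" "continuous_on K g" "\<And>s. s \<in> K \<Longrightarrow> norm (g s) < e"
  obtains r where "r > 0" "\<And>s. s \<in> K \<Longrightarrow> norm (g s) + r \<le> e"
proof (cases "K = {}")
  case False
  obtain m where m: "m \<in> K" "\<And>s. s \<in> K \<Longrightarrow> norm (g s) \<le> norm (g m)"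
    using continuous_attains_sup[OF assms(1) False continuous_on_norm[OF assms(2)]] by blast
  show ?thesis using that[of "e - norm (g m)"] assms(3) m by force
qed (use that[of 1] in auto)

lemma openin_C1_ball:
  fixes \<phi> :: "real \<Rightarrow> real^'n"
  assumes K: "compact K" "K \<subseteq> J" and \<phi>: "\<phi> \<in> C1 J"
  shows "openin (C1_top J) (C1_ball J K \<epsilon> \<phi>)"
  unfolding openin_C1_top C1_open_def
proof (intro conjI ballI)
  show "C1_ball J K \<epsilon> \<phi> \<subseteq> C1 J" by (auto simp: C1_ball_def)
  fix \<psi> assume \<psi>: "\<psi> \<in> C1_ball J K \<epsilon> \<phi>"
  then have \<psi>1: "\<psi> \<in> C1 J" by (simp add: C1_ball_def)
  have c: "continuous_on K (\<lambda>s. \<psi> s - \<phi> s)" "continuous_on K (\<lambda>s. hderiv J \<psi> s - hderiv J \<phi> s)"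
    using C1_continuous_on[OF \<phi>] C1_continuous_on[OF \<psi>1] K(2)
    by (auto intro!: continuous_on_diff intro: continuous_on_subset)
  obtain r where r: "r > 0" "\<And>s. s \<in> K \<Longrightarrow> norm (\<psi> s - \<phi> s) + r \<le> \<epsilon>"
    using compact_norm_less_gap[OF K(1) c(1), of \<epsilon>] \<psi> by (auto simp: C1_ball_def)
  obtain r' where r': "r' > 0" "\<And>s. s \<in> K \<Longrightarrow> norm (hderiv J \<psi> s - hderiv J \<phi> s) + r' \<le> \<epsilon>"
    using compact_norm_less_gap[OF K(1) c(2), of \<epsilon>] \<psi> by (auto simp: C1_ball_def)
  have "\<omega> \<in> C1_ball J K \<epsilon> \<phi>" if \<omega>: "\<omega> \<in> C1_ball J K (min r r') \<psi>" for \<omega>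
    unfolding C1_ball_def
  proof (intro CollectI conjI ballI)
    show "\<omega> \<in> C1 J" using \<omega> by (simp add: C1_ball_def)
    fix s assume s: "s \<in> K"
    then have "norm (\<omega> s - \<psi> s) < r" "norm (hderiv J \<omega> s - hderiv J \<psi> s) < r'"
      using \<omega> by (auto simp: C1_ball_def)
    then show "norm (\<omega> s - \<phi> s) < \<epsilon>" "norm (hderiv J \<omega> s - hderiv J \<phi> s) < \<epsilon>"
      using norm_triangle_ineq[of "\<omega> s - \<psi> s" "\<psi> s - \<phi> s"] r(2)[OF s] r'(2)[OF s]
        norm_triangle_ineq[of "hderiv J \<omega> s - hderiv J \<psi> s" "hderiv J \<psi> s - hderiv J \<phi> s"] by auto
  qed
  then have "C1_ball J K (min r r') \<psi> \<subseteq> C1_ball J K \<epsilon> \<phi>" by blast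
  then show "\<exists>L \<delta>. compact L \<and> L \<subseteq> J \<and> \<delta> > 0 \<and>
      {\<omega> \<in> C1 J. \<forall>s\<in>L. norm (\<omega> s - \<psi> s) < \<delta> \<and> norm (hderiv J \<omega> s - hderiv J \<psi> s) < \<delta>}
        \<subseteq> C1_ball J K \<epsilon> \<phi>"
    using K r(1) r'(1) unfolding C1_ball_def[of J K "min r r'"]
    by (intro exI[of _ K] exI[of _ "min r r'"]) auto
qed

lemma openin_C1_topE:
  fixes O' :: "(real \<Rightarrow> real^'n) set"
  assumes "openin (C1_top J) O'" "\<phi> \<in> O'"
  obtains K \<epsilon> where "compact K" "K \<subseteq> J" "\<epsilon> > 0" "C1_ball J K \<epsilon> \<phi> \<subseteq> O'"
proof -
  have "\<exists>K \<epsilon>. compact K \<and> K \<subseteq> J \<and> \<epsilon> > 0 \<and> C1_ball J K \<epsilon> \<phi> \<subseteq> O'"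
    using assms unfolding openin_C1_top C1_open_def C1_ball_def by blast
  then show ?thesis using that by blast
qed

lemma centre_in_C1_ball: "\<phi> \<in> C1 J \<Longrightarrow> \<epsilon> > 0 \<Longrightarrow> \<phi> \<in> C1_ball J K \<epsilon> \<phi>"
  by (simp add: C1_ball_def)

lemma zero_in_Cont: "(0 :: real \<Rightarrow> real^'n) \<in> Cont J"
proof -
  have "continuous_on J (0 :: real \<Rightarrow> real^'n)" unfolding zero_fun_def by (rule continuous_on_const)
  then show ?thesis by (simp add: Cont_def)
qed

text \<open>Makes a directional derivative of \<open>f\<close> an ordinary derivative along a line,
  to which the mean value inequality applies.\<close>

lemma has_dir_deriv_imp_has_vector_derivative:
  fixes f :: "(real \<Rightarrow> real^'n) \<Rightarrow> real^'n"
  assumes "has_dir_deriv euclidean f (u + r *\<^sub>R v) v l"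
  shows "((\<lambda>r. f (u + r *\<^sub>R v)) has_vector_derivative l) (at r)"
proof -
  have *: "(\<lambda>t. (1 / t) *\<^sub>R (f (u + (r + t) *\<^sub>R v) - f (u + r *\<^sub>R v))) \<midarrow>0\<rightarrow> l"
    using assms by (simp add: has_dir_deriv_def scaleR_add_left add.assoc)
  have "(\<lambda>t. norm ((1 / t) *\<^sub>R (f (u + (r + t) *\<^sub>R v) - f (u + r *\<^sub>R v)) - l)) \<midarrow>0\<rightarrow> 0"
    using tendsto_norm_zero[OF LIM_zero[OF *]] .
  moreover have "\<forall>\<^sub>F t in at 0.
      norm ((1 / t) *\<^sub>R (f (u + (r + t) *\<^sub>R v) - f (u + r *\<^sub>R v)) - l)
      = norm (f (u + (r + t) *\<^sub>R v) - f (u + r *\<^sub>R v) - t *\<^sub>R l) / norm t"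
    unfolding eventually_at
  proof (intro exI[of _ 1] conjI ballI impI)
    fix t :: real assume t: "t \<noteq> 0 \<and> dist t 0 < 1"
    let ?D = "f (u + (r + t) *\<^sub>R v) - f (u + r *\<^sub>R v)"
    have "(1 / t) *\<^sub>R ?D - l = (1 / t) *\<^sub>R (?D - t *\<^sub>R l)"
      using t by (simp add: scaleR_diff_right)
    then show "norm ((1 / t) *\<^sub>R ?D - l) = norm (?D - t *\<^sub>R l) / norm t"
      by simp
  qed simp
  ultimately show ?thesis
    unfolding has_vector_derivative_def has_derivative_at
    by (auto simp: bounded_linear_scaleR_left intro: Lim_transform_eventually)
qed

section \<open>History intervals: the half-line and [-d,0] treated together\<close>

locale history_interval =
  fixes J :: "real set"
  assumes interval: "is_interval J"
    and le_0: "J \<subseteq> {..0}"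
    and nontrivial: "\<exists>\<delta>>0. {-\<delta>..0} \<subseteq> J"
begin

lemma zero_mem: "0 \<in> J"
  using nontrivial by force

lemma between_mem: "s \<in> J \<Longrightarrow> s \<le> u \<Longrightarrow> u \<le> 0 \<Longrightarrow> u \<in> J"
  using interval zero_mem by (metis mem_is_interval_1_I)

text \<open>A connected set with more than one point has no isolated points. Hence derivatives
  within \<open>J\<close> are unique, also at its end points.\<close>

lemma at_within_neq_bot: "s \<in> J \<Longrightarrow> at s within J \<noteq> bot"
proof -
  assume s: "s \<in> J"
  obtain \<delta> where "\<delta> > 0" "{-\<delta>..0} \<subseteq> J" using nontrivial by blast
  then have "-\<delta> \<in> J" "-\<delta> \<noteq> 0" by auto
  then have "J \<noteq> {x}" for x using zero_mem by (metis singletonD)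
  then show ?thesis
    using connected_imp_perfect[OF _ s] interval is_interval_connected
    by (auto simp: trivial_limit_within)
qed

lemma hderiv_eqI:
  "s \<in> J \<Longrightarrow> (\<phi> has_vector_derivative D) (at s within J) \<Longrightarrow> hderiv J \<phi> s = D"
  unfolding hderiv_def by (rule vector_derivative_within[OF at_within_neq_bot])

lemma C1I:
  assumes "\<And>s. s \<in> J \<Longrightarrow> (\<phi> has_vector_derivative D s) (at s within J)"
    and "continuous_on J D" "\<And>s. s \<notin> J \<Longrightarrow> \<phi> s = 0"
  shows "\<phi> \<in> C1 J"
proof -
  have "continuous_on J (hderiv J \<phi>)"
    using assms(2) by (rule continuous_on_eq) (simp add: hderiv_eqI[OF _ assms(1)])
  moreover have "continuous_on J \<phi>"
    using assms(1) has_vector_derivative_continuous continuous_on_eq_continuous_within by blast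
  ultimately show ?thesis
    using assms(1,3) by (auto simp: C1_def Cont_def has_vector_derivative_def differentiable_def)
qed

lemma C1_add_scaleR:
  assumes "\<phi> \<in> C1 J" "\<psi> \<in> C1 J"
  shows "\<phi> + r *\<^sub>R \<psi> \<in> C1 J"
    and "s \<in> J \<Longrightarrow> hderiv J (\<phi> + r *\<^sub>R \<psi>) s = hderiv J \<phi> s + r *\<^sub>R hderiv J \<psi> s"
proof -
  have eq: "\<phi> + r *\<^sub>R \<psi> = (\<lambda>s. \<phi> s + r *\<^sub>R \<psi> s)"
    by (simp add: fun_eq_iff scaleR_fun_def)
  have d: "(\<phi> + r *\<^sub>R \<psi> has_vector_derivative hderiv J \<phi> s + r *\<^sub>R hderiv J \<psi> s) (at s within J)"
    if "s \<in> J" for s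
    unfolding eq using assms that
    by (intro has_vector_derivative_add C1_imp_has_vector_derivative
        bounded_linear.has_vector_derivative[OF bounded_linear_scaleR_right])
  show "s \<in> J \<Longrightarrow> hderiv J (\<phi> + r *\<^sub>R \<psi>) s = hderiv J \<phi> s + r *\<^sub>R hderiv J \<psi> s"
    using d hderiv_eqI by blast
  show "\<phi> + r *\<^sub>R \<psi> \<in> C1 J"
  proof (rule C1I[OF d])
    show "continuous_on J (\<lambda>s. hderiv J \<phi> s + r *\<^sub>R hderiv J \<psi> s)"
      using assms by (intro continuous_intros C1_continuous_on)
    show "(\<phi> + r *\<^sub>R \<psi>) s = 0" if "s \<notin> J" for s
      using assms that by (simp add: C1_def Cont_def scaleR_fun_def)
  qed
qed

text \<open>At each argument in \<open>K\<close> both conditions ask for membership in a ball of a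
  Euclidean space, which is convex. The mean value inequality for \<open>f\<close> needs the whole
  line between two maps.\<close>

lemma C1_ball_convex:
  assumes "\<phi> \<in> C1_ball J K \<epsilon> \<omega>" "\<psi> \<in> C1_ball J K \<epsilon> \<omega>" "K \<subseteq> J" "0 \<le> r" "r \<le> 1"
  shows "\<phi> + r *\<^sub>R (\<psi> - \<phi>) \<in> C1_ball J K \<epsilon> \<omega>"
proof -
  have \<phi>: "\<phi> \<in> C1 J" and \<psi>: "\<psi> \<in> C1 J" using assms by (auto simp: C1_ball_def)
  have eq: "\<psi> - \<phi> = \<psi> + (-1) *\<^sub>R \<phi>" by simp
  have d: "\<psi> - \<phi> \<in> C1 J" using C1_add_scaleR(1)[OF \<psi> \<phi>, of "-1"] by simp
  have conv: "norm (a + r *\<^sub>R (b - a) - c) < \<epsilon>" if "norm (a - c) < \<epsilon>" "norm (b - c) < \<epsilon>"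
    for a b c :: "real^'a"
  proof -
    have "(1 - r) *\<^sub>R a + r *\<^sub>R b \<in> ball c \<epsilon>"
      by (rule convexD[OF convex_ball]) (use that assms(4,5) in \<open>auto simp: dist_norm norm_minus_commute\<close>)
    moreover have "(1 - r) *\<^sub>R a + r *\<^sub>R b = a + r *\<^sub>R (b - a)" by (simp add: algebra_simps)
    ultimately show ?thesis by (simp add: dist_norm norm_minus_commute)
  qed
  show ?thesis
    unfolding C1_ball_def
  proof (intro CollectI conjI ballI)
    show "\<phi> + r *\<^sub>R (\<psi> - \<phi>) \<in> C1 J" using C1_add_scaleR(1)[OF \<phi> d] .
    fix s assume s: "s \<in> K"
    then have sJ: "s \<in> J" using assms(3) by blast
    show "norm ((\<phi> + r *\<^sub>R (\<psi> - \<phi>)) s - \<omega> s) < \<epsilon>"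
      using conv[of "\<phi> s" "\<omega> s" "\<psi> s"] assms(1,2) s by (simp add: C1_ball_def scaleR_fun_def)
    have "hderiv J (\<psi> - \<phi>) s = hderiv J \<psi> s - hderiv J \<phi> s"
      using C1_add_scaleR(2)[OF \<psi> \<phi> sJ, of "-1"] by simp
    then show "norm (hderiv J (\<phi> + r *\<^sub>R (\<psi> - \<phi>)) s - hderiv J \<omega> s) < \<epsilon>"
      using conv[of "hderiv J \<phi> s" "hderiv J \<omega> s" "hderiv J \<psi> s"] assms(1,2) s
      by (simp add: C1_ball_def C1_add_scaleR(2)[OF \<phi> d sJ])
  qed
qed

end

section \<open>Local Lipschitz continuity of the right-hand side without derivatives of the
  argument\<close>

locale delay_equation = history_interval J for J +
  fixes U :: "(real \<Rightarrow> real^'n) set" and f :: "(real \<Rightarrow> real^'n) \<Rightarrow> real^'n"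
    and De :: "(real \<Rightarrow> real^'n) \<Rightarrow> (real \<Rightarrow> real^'n) \<Rightarrow> real^'n"
  assumes U: "openin (C1_top J) U" and De: "extended_derivative J U f De"
begin

lemma U_subset: "U \<subseteq> C1 J"
  using openin_subset[OF U] by simp

text \<open>The extension of the derivative to \<open>C\<close> makes \<open>f\<close> locally Lipschitz with respect to the norms
  of \<open>C\<close>, which do not involve derivatives.\<close>

lemma locally_lipschitz:
  assumes \<phi>: "\<phi> \<in> U"
  obtains O' K L where "openin (C1_top J) O'" "\<phi> \<in> O'" "O' \<subseteq> U" "K \<subseteq> J" "L > 0"
    "\<And>\<psi> \<omega> e. \<psi> \<in> O' \<Longrightarrow> \<omega> \<in> O' \<Longrightarrow> e > 0 \<Longrightarrow> (\<And>s. s \<in> K \<Longrightarrow> norm (\<omega> s - \<psi> s) \<le> e)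
       \<Longrightarrow> norm (f \<omega> - f \<psi>) \<le> L * e"
proof -
  \<comment> \<open>The preimage of the unit ball under the extended derivative is open by joint
    continuity, and it contains the pair of \<phi> and the zero map by linearity in the second
    argument.\<close>
  let ?W = "{(\<psi>, \<xi>) \<in> U \<times> Cont J. De \<psi> \<xi> \<in> ball 0 1}"
  have U1: "U \<inter> C1 J = U" "C1 J \<inter> U = U" using U_subset by auto
  have lin: "De \<psi> (r *\<^sub>R \<xi>) = r *\<^sub>R De \<psi> \<xi>" if "\<psi> \<in> U" "\<xi> \<in> Cont J" for \<psi> \<xi> r
    using De that unfolding extended_derivative_def by blast
  have cont: "continuous_map (prod_topology (subtopology (C1_top J) U) (Cont_top J)) euclidean
         (\<lambda>(\<phi>, \<xi>). De \<phi> \<xi>)"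
    using De unfolding extended_derivative_def by blast
  have "{p \<in> U \<times> Cont J. (\<lambda>(\<phi>, \<xi>). De \<phi> \<xi>) p \<in> ball 0 1} = ?W" by auto
  then have "openin (prod_topology (subtopology (C1_top J) U) (Cont_top J)) ?W"
    using openin_continuous_map_preimage[OF cont, of "ball 0 1"] U1 by (simp add: topspace_subtopology)
  moreover have "(\<phi>, 0) \<in> ?W" using lin[OF \<phi> zero_in_Cont, of 0] \<phi> zero_in_Cont by auto
  ultimately obtain A B where A: "openin (subtopology (C1_top J) U) A" "\<phi> \<in> A"
    and B: "openin (Cont_top J) B" "0 \<in> B" and AB: "A \<times> B \<subseteq> ?W"
    unfolding openin_prod_topology_alt by meson
  have "openin (C1_top J) A" using A(1) U openin_trans_full by blast
  then obtain K' \<epsilon>' where K': "compact K'" "K' \<subseteq> J" "\<epsilon>' > 0" "C1_ball J K' \<epsilon>' \<phi> \<subseteq> A"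
    using A(2) openin_C1_topE by blast
  \<comment> \<open>The second factor is a neighbourhood of 0 in C, hence described by values only.
    This is why the estimate in the end involves no derivatives.\<close>
  obtain K \<epsilon> where K: "K \<subseteq> J" "\<epsilon> > 0"
      "\<And>\<xi>. \<xi> \<in> Cont J \<Longrightarrow> (\<And>s. s \<in> K \<Longrightarrow> norm (\<xi> s) < \<epsilon>) \<Longrightarrow> \<xi> \<in> B"
  proof -
    have "\<exists>K \<epsilon>. compact K \<and> K \<subseteq> J \<and> \<epsilon> > 0 \<and> {\<psi> \<in> Cont J. \<forall>s\<in>K. norm (\<psi> s - 0 s) < \<epsilon>} \<subseteq> B"
      using B unfolding openin_Cont_top Cont_open_def by blast
    then show ?thesis using that by (auto simp: subset_iff)
  qed
  have \<phi>1: "\<phi> \<in> C1 J" using \<phi> U_subset by blast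
  have AU: "A \<subseteq> U" using AB B(2) by auto
  show ?thesis
  proof (rule that[of "C1_ball J K' \<epsilon>' \<phi>" K "2 / \<epsilon>"])
    show "openin (C1_top J) (C1_ball J K' \<epsilon>' \<phi>)" using openin_C1_ball[OF K'(1,2) \<phi>1] .
    show "\<phi> \<in> C1_ball J K' \<epsilon>' \<phi>" using centre_in_C1_ball[OF \<phi>1 K'(3)] .
    show "C1_ball J K' \<epsilon>' \<phi> \<subseteq> U" using K'(4) AU by blast
    show "K \<subseteq> J" "2 / \<epsilon> > 0" using K by auto
    fix \<psi> \<omega> :: "real \<Rightarrow> real^'n" and e :: real
    assume \<psi>: "\<psi> \<in> C1_ball J K' \<epsilon>' \<phi>" and \<omega>: "\<omega> \<in> C1_ball J K' \<epsilon>' \<phi>" and e: "e > 0"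
      and le: "\<And>s. s \<in> K \<Longrightarrow> norm (\<omega> s - \<psi> s) \<le> e"
    define \<xi> where "\<xi> = \<omega> - \<psi>"
    have \<omega>1: "\<omega> \<in> C1 J" and \<psi>1: "\<psi> \<in> C1 J" using \<psi> \<omega> by (auto simp: C1_ball_def)
    have \<xi>: "\<xi> \<in> C1 J" using C1_add_scaleR(1)[OF \<omega>1 \<psi>1, of "-1"] by (simp add: \<xi>_def)
    have bound: "norm (De \<eta> \<xi>) \<le> 2 / \<epsilon> * e" if \<eta>: "\<eta> \<in> A" for \<eta>
    proof -
      \<comment> \<open>Homogeneity: \<xi> is scaled into \<open>B\<close>, where the extended
        derivative is below 1. The factor 2 provides the strict inequality r * e < \<epsilon>, since
        \<open>le\<close> is not strict, and reappears in the constant 2 / \<epsilon>.\<close>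
      define r where "r = \<epsilon> / (2 * e)"
      have r: "r > 0" "r * e < \<epsilon>" using K(2) e by (auto simp: r_def)
      have C: "r *\<^sub>R \<xi> \<in> Cont J"
        using \<xi> by (auto simp: C1_def Cont_def scaleR_fun_def intro!: continuous_intros)
      have "r *\<^sub>R \<xi> \<in> B"
      proof (rule K(3)[OF C])
        fix s assume "s \<in> K"
        then have "norm (\<xi> s) \<le> e" using le by (simp add: \<xi>_def)
        then have "r * norm (\<xi> s) \<le> r * e" using r(1) by simp
        then show "norm ((r *\<^sub>R \<xi>) s) < \<epsilon>"
          using r(1) le_less_trans[OF _ r(2)] by (simp add: scaleR_fun_def)
      qed
      then have "norm (De \<eta> (r *\<^sub>R \<xi>)) < 1" using \<eta> AB by auto
      moreover have "De \<eta> (r *\<^sub>R \<xi>) = r *\<^sub>R De \<eta> \<xi>"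
        using lin[of \<eta> \<xi> r] \<eta> AU \<xi> by (auto simp: C1_def)
      ultimately have "r * norm (De \<eta> \<xi>) < 1" using r(1) by simp
      then have "norm (De \<eta> \<xi>) < 1 / r" using r(1) by (simp add: field_simps)
      then show ?thesis using e K(2) by (simp add: r_def field_simps)
    qed
    have inA: "\<psi> + r *\<^sub>R \<xi> \<in> A" if "0 \<le> r" "r \<le> 1" for r
      using C1_ball_convex[OF \<psi> \<omega> K'(2) that] K'(4) by (auto simp: \<xi>_def)
    define g where "g r = f (\<psi> + r *\<^sub>R \<xi>)" for r
    have g: "(g has_vector_derivative De (\<psi> + r *\<^sub>R \<xi>) \<xi>) (at r)" if "0 \<le> r" "r \<le> 1" for r
    proof -
      have "has_dir_deriv euclidean f (\<psi> + r *\<^sub>R \<xi>) \<xi> (De (\<psi> + r *\<^sub>R \<xi>) \<xi>)"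
        using De inA[OF that] AU \<xi> unfolding extended_derivative_def by blast
      then show ?thesis
        unfolding g_def by (rule has_dir_deriv_imp_has_vector_derivative)
    qed
    \<comment> \<open>Mean value inequality on the line from \<psi> to \<omega>, which runs inside
      the convex ball and hence inside \<open>A\<close>.\<close>
    have "norm (g 1 - g 0) \<le> 2 / \<epsilon> * e * 1 - 2 / \<epsilon> * e * 0"
    proof (rule differentiable_bound_general)
      show "continuous_on {0..1} g"
        using g by (intro continuous_at_imp_continuous_on ballI)
          (auto intro: has_vector_derivative_continuous)
      show "((\<lambda>r. 2 / \<epsilon> * e * r) has_vector_derivative 2 / \<epsilon> * e) (at r)" for r
        using K(2) by (auto intro!: derivative_eq_intros
            simp flip: has_real_derivative_iff_has_vector_derivative)
      show "(g has_vector_derivative De (\<psi> + r *\<^sub>R \<xi>) \<xi>) (at r)" if "0 < r" "r < 1" for r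
        using g that by simp
      show "norm (De (\<psi> + r *\<^sub>R \<xi>) \<xi>) \<le> 2 / \<epsilon> * e" if "0 < r" "r < 1" for r
        using bound inA that by simp
      show "continuous_on {0..1} (\<lambda>r. 2 / \<epsilon> * e * r)"
        by (intro continuous_on_mult_left continuous_on_id)
    qed simp
    then show "norm (f \<omega> - f \<psi>) \<le> 2 / \<epsilon> * e" using K(2) by (simp add: g_def \<xi>_def)
  qed
qed

end

section \<open>Solutions as continuously differentiable curves\<close>

text \<open>For T > 0 this is the set \<open>J\<close> + [0,T), written without sums. Time 0 belongs
  to it, although \<open>ivp_solution\<close> poses the equation at positive times only.\<close>

definition history_domain :: "real set \<Rightarrow> ereal \<Rightarrow> real set" where
  "history_domain J T = J \<union> {t. 0 \<le> t \<and> ereal t < T}"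

text \<open>The derivative is a function of its own because it is pieced together from histories and
  right-hand sides. At a left end point of \<open>J\<close> it is one-sided.\<close>

definition C1_path :: "real set \<Rightarrow> ereal \<Rightarrow> (real \<Rightarrow> real^'n) \<Rightarrow> (real \<Rightarrow> real^'n) \<Rightarrow> bool" where
  "C1_path J T x x' \<longleftrightarrow>
     (\<forall>t\<in>history_domain J T. (x has_vector_derivative x' t) (at t within history_domain J T))
     \<and> continuous_on (history_domain J T) x'"

lemma ereal_add_gap:
  assumes "ereal t < T"
  obtains \<eta> where "\<eta> > 0" "ereal (t + \<eta>) < T"
proof (cases T)
  case (real r)
  then show ?thesis using assms that[of "(r - t) / 2"] by (auto simp: field_simps)
qed (use assms that[of 1] in auto)

lemma segment_0_eqD: "segment J x 0 = \<phi> \<Longrightarrow> s \<in> J \<Longrightarrow> x s = \<phi> s"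
  by (auto simp: segment_def)

context history_interval
begin

lemma add_mem_history_domain:
  assumes "0 \<le> t" "ereal t < T" "s \<in> J"
  shows "t + s \<in> history_domain J T"
proof (cases "t + s < 0")
  case True
  then have "t + s \<in> J" using between_mem[OF assms(3), of "t + s"] assms(1) by simp
  then show ?thesis by (simp add: history_domain_def)
next
  case False
  have "t + s \<le> t" using assms(3) le_0 by auto
  then have "ereal (t + s) < T" using assms(2) by (meson ereal_less_eq(3) le_less_trans)
  then show ?thesis using False by (simp add: history_domain_def)
qed

text \<open>The two-sided derivative exists at positive times because the equation holds slightly later.\<close>

lemma ivp_solution_iff:
  "ivp_solution J U f \<phi> T x \<longleftrightarrow> 0 < T \<and> segment J x 0 = \<phi> \<and>
     (\<forall>t. 0 < t \<and> ereal t < T \<longrightarrow> segment J x t \<in> U \<and>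
        (x has_vector_derivative f (segment J x t)) (at t))"
proof -
  let ?S = "{s + t' |s t'. s \<in> J \<and> t' \<in> {t. 0 < t \<and> ereal t < T}}"
  have "at t within ?S = at t" if t: "0 < t" "ereal t < T" for t
  proof -
    obtain \<eta> where \<eta>: "\<eta> > 0" "ereal (t + \<eta>) < T" using ereal_add_gap[OF t(2)] .
    obtain \<delta> where \<delta>: "\<delta> > 0" "{-\<delta>..0} \<subseteq> J" using nontrivial by blast
    \<comment> \<open>Every time near t has the form s + (t + \<epsilon>) with s in
      \<open>J\<close>: t + \<epsilon> is still below T, and s runs over an interval of length 2 *
      \<epsilon> below 0.\<close>
    define \<epsilon> where "\<epsilon> = min \<eta> (\<delta> / 2)"
    have \<epsilon>: "\<epsilon> > 0" "2 * \<epsilon> \<le> \<delta>" "\<epsilon> \<le> \<eta>" using \<eta> \<delta> by (auto simp: \<epsilon>_def)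
    have T: "ereal (t + \<epsilon>) < T" using \<eta>(2) \<epsilon>(3) by (meson add_left_mono ereal_less_eq(3) le_less_trans)
    have "{t - \<epsilon><..<t + \<epsilon>} \<subseteq> ?S"
    proof
      fix u assume u: "u \<in> {t - \<epsilon><..<t + \<epsilon>}"
      have "u - (t + \<epsilon>) \<in> J" using u \<epsilon> \<delta>(2) by auto
      moreover have "u = (u - (t + \<epsilon>)) + (t + \<epsilon>)" by simp
      ultimately show "u \<in> ?S" using T t(1) \<epsilon>(1)
        by (metis (mono_tags, lifting) add_pos_pos mem_Collect_eq)
    qed
    then have "t \<in> interior ?S" using \<epsilon>(1) by (intro interiorI[of "{t - \<epsilon><..<t + \<epsilon>}"]) auto
    then show ?thesis by (rule at_within_interior)
  qed
  then show ?thesis unfolding ivp_solution_def solution_on_def by auto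
qed

lemma ivp_solution_mono:
  assumes "ivp_solution J U f \<phi> T x" "0 < T'" "T' \<le> T"
  shows "ivp_solution J U f \<phi> T' x"
  using assms unfolding ivp_solution_iff by (meson less_le_trans)

lemma C1_path_segment:
  assumes "C1_path J T x x'" "0 \<le> t" "ereal t < T"
  shows "segment J x t \<in> C1 J" and "\<And>s. s \<in> J \<Longrightarrow> hderiv J (segment J x t) s = x' (t + s)"
proof -
  have sub: "(+) t ` J \<subseteq> history_domain J T"
    using add_mem_history_domain[OF assms(2,3)] by blast
  have d: "(segment J x t has_vector_derivative x' (t + s)) (at s within J)" if "s \<in> J" for s
  proof -
    have "((+) t has_vector_derivative 1) (at s within J)"
      by (auto intro!: derivative_eq_intros simp flip: has_real_derivative_iff_has_vector_derivative)
    moreover have "(x has_vector_derivative x' (t + s)) (at (t + s) within (+) t ` J)"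
      using assms(1) sub that unfolding C1_path_def
      by (meson has_vector_derivative_within_subset imageI subsetD)
    ultimately have "(x \<circ> (+) t has_vector_derivative x' (t + s)) (at s within J)"
      using vector_diff_chain_within by fastforce
    then show ?thesis
      by (rule has_vector_derivative_transform_within[OF _ zero_less_one that])
        (simp add: segment_def)
  qed
  show "\<And>s. s \<in> J \<Longrightarrow> hderiv J (segment J x t) s = x' (t + s)"
    using d hderiv_eqI by blast
  have "continuous_on J (\<lambda>s. x' (t + s))"
    using assms(1) sub unfolding C1_path_def
    by (intro continuous_on_compose2[of _ x' J "(+) t"]) (auto intro: continuous_intros)
  then show "segment J x t \<in> C1 J"
    by (intro C1I[OF d]) (auto simp: segment_def)
qed

lemma C1_path_continuous:
  "C1_path J T x x' \<Longrightarrow> continuous_on (history_domain J T) x"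
  unfolding C1_path_def
  using has_vector_derivative_continuous continuous_on_eq_continuous_within by blast

text \<open>Closeness of segments on a compact \<open>K\<close> concerns x and x' on a compact set
  of times, where both are uniformly continuous. This is continuity of the curve of segments in the
  topology of C1.\<close>

lemma segment_continuous:
  fixes x :: "real \<Rightarrow> real^'n"
  assumes x: "C1_path J T x x'" and t: "0 \<le> t" "ereal t < T"
    and O': "openin (C1_top J) O'" "segment J x t \<in> O'"
  obtains \<eta> where "\<eta> > 0" "ereal (t + \<eta>) < T"
    "\<forall>u. 0 \<le> u \<and> t - \<eta> \<le> u \<and> u \<le> t + \<eta> \<longrightarrow> segment J x u \<in> O'"
proof -
  obtain K \<epsilon> where K: "compact K" "K \<subseteq> J" "\<epsilon> > 0" "C1_ball J K \<epsilon> (segment J x t) \<subseteq> O'"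
    using openin_C1_topE[OF O'] .
  obtain b where b: "b > 0" "ereal (t + b) < T" using ereal_add_gap[OF t(2)] .
  define C where "C = {u + s |u s. u \<in> {0..t + b} \<and> s \<in> K}"
  have C: "compact C" unfolding C_def by (intro compact_sums compact_Icc K(1))
  have less_T: "ereal u < T" if "u \<le> t + b" for u
    using that b(2) by (meson ereal_less_eq(3) le_less_trans)
  have CD: "C \<subseteq> history_domain J T"
    using add_mem_history_domain less_T K(2) by (force simp: C_def)
  have "continuous_on C x" "continuous_on C x'"
    using CD C1_path_continuous[OF x] x unfolding C1_path_def by (auto intro: continuous_on_subset)
  then have "uniformly_continuous_on C x" "uniformly_continuous_on C x'"
    using C compact_uniformly_continuous by auto
  then have "\<exists>e>0. \<forall>u\<in>C. \<forall>v\<in>C. dist v u < e \<longrightarrow> dist (x v) (x u) < \<epsilon>"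
      "\<exists>e>0. \<forall>u\<in>C. \<forall>v\<in>C. dist v u < e \<longrightarrow> dist (x' v) (x' u) < \<epsilon>"
    using K(3) by (simp_all add: uniformly_continuous_on_def)
  then obtain e e' where e: "e > 0" "e' > 0"
    and ux: "\<And>u v. u \<in> C \<Longrightarrow> v \<in> C \<Longrightarrow> dist v u < e \<Longrightarrow> dist (x v) (x u) < \<epsilon>"
    and ux': "\<And>u v. u \<in> C \<Longrightarrow> v \<in> C \<Longrightarrow> dist v u < e' \<Longrightarrow> dist (x' v) (x' u) < \<epsilon>"
    by blast
  define \<eta> where "\<eta> = min b (min e e' / 2)"
  have \<eta>: "\<eta> > 0" "\<eta> \<le> b" "\<eta> < e" "\<eta> < e'" using b e by (auto simp: \<eta>_def)
  show ?thesis
  proof (rule that[OF \<eta>(1)], safe)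
    show "ereal (t + \<eta>) < T" using less_T \<eta> by simp
    fix u assume u: "0 \<le> u" "t - \<eta> \<le> u" "u \<le> t + \<eta>"
    have uT: "ereal u < T" using less_T u \<eta> by simp
    have "segment J x u \<in> C1_ball J K \<epsilon> (segment J x t)"
      unfolding C1_ball_def
    proof (intro CollectI conjI ballI)
      show "segment J x u \<in> C1 J" using C1_path_segment(1)[OF x u(1) uT] .
      fix s assume s: "s \<in> K"
      then have sJ: "s \<in> J" using K(2) by blast
      have mem: "t + s \<in> C" "u + s \<in> C"
        using s u \<eta> t(1) b(1) unfolding C_def by fastforce+
      have "dist (u + s) (t + s) < e" "dist (u + s) (t + s) < e'"
        using u \<eta> by (auto simp: dist_real_def)
      then have "dist (x (u + s)) (x (t + s)) < \<epsilon>" "dist (x' (u + s)) (x' (t + s)) < \<epsilon>"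
        using ux ux' mem by blast+
      then show "norm (segment J x u s - segment J x t s) < \<epsilon>"
          "norm (hderiv J (segment J x u) s - hderiv J (segment J x t) s) < \<epsilon>"
        unfolding C1_path_segment(2)[OF x t sJ] C1_path_segment(2)[OF x u(1) uT sJ]
        using sJ by (simp_all add: segment_def dist_norm)
    qed
    then show "segment J x u \<in> O'" using K(4) by blast
  qed
qed

text \<open>\<open>J\<close> contains an interval to the left of 0, so that time 0 is interior as
  well and paths have two-sided derivatives from 0 on.\<close>

lemma history_domain_interior:
  assumes "0 \<le> t" "ereal t < T"
  shows "t \<in> interior (history_domain J T)"
proof -
  obtain \<eta> where \<eta>: "\<eta> > 0" "ereal (t + \<eta>) < T" using ereal_add_gap[OF assms(2)] .
  obtain \<delta> where \<delta>: "\<delta> > 0" "{-\<delta>..0} \<subseteq> J" using nontrivial by blast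
  have "{t - \<delta><..<t + \<eta>} \<subseteq> history_domain J T"
  proof
    fix u assume u: "u \<in> {t - \<delta><..<t + \<eta>}"
    then have "ereal u < T" using \<eta>(2) by (meson ereal_less(2) ereal_less_eq(3) greaterThanLessThan_iff
          le_less_trans less_imp_le)
    then show "u \<in> history_domain J T"
      using u \<delta>(2) assms(1) by (cases "u < 0") (auto simp: history_domain_def)
  qed
  then show ?thesis
    using \<eta>(1) \<delta>(1) by (intro interiorI[of "{t - \<delta><..<t + \<eta>}"]) auto
qed

lemma C1_path_at:
  assumes "C1_path J T x x'" "0 \<le> t" "ereal t < T"
  shows "(x has_vector_derivative x' t) (at t)"
proof -
  have "t \<in> history_domain J T" using assms(2,3) by (simp add: history_domain_def)
  then show ?thesis
    using assms(1) at_within_interior[OF history_domain_interior[OF assms(2,3)]]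
    unfolding C1_path_def by metis
qed

text \<open>Regularity is inherited from the segments, which lie in C1: the derivative near a time t
  \<ge> 0 is read off from a segment taken slightly later, in which t is an interior argument. At t
  = 0 this makes history and solution fit together.\<close>

lemma ivp_solution_C1_path:
  fixes x :: "real \<Rightarrow> real^'n"
  assumes x: "ivp_solution J U f \<phi> T x" and \<phi>: "\<phi> \<in> C1 J" and U: "U \<subseteq> C1 J"
  obtains x' where "C1_path J T x x'"
    "\<forall>t. 0 < t \<and> ereal t < T \<longrightarrow> x' t = f (segment J x t)"
    "\<forall>s\<in>J. x' s = hderiv J \<phi> s"
proof -
  let ?D = "history_domain J T"
  define x' where "x' t = (if t < 0 then hderiv J \<phi> t else vector_derivative x (at t))" for t
  have x0: "segment J x 0 = \<phi>" and Tpos: "0 < T" using x unfolding ivp_solution_iff by auto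
  have xJ: "(x has_vector_derivative hderiv J \<phi> s) (at s within J)" if "s \<in> J" for s
    by (rule has_vector_derivative_transform_within
        [OF C1_imp_has_vector_derivative[OF \<phi> that] zero_less_one that])
      (simp add: segment_0_eqD[OF x0])
  \<comment> \<open>Continuity is a local matter, so near t it suffices to compare x' with one
    function continuous at t: the derivative of the history if t < 0, that of a later segment
    otherwise.\<close>
  have local: "\<exists>g \<epsilon>. \<epsilon> > 0 \<and> continuous (at t within ?D) g \<and>
      (\<forall>u\<in>?D. dist u t < \<epsilon> \<longrightarrow> x' u = g u \<and> (x has_vector_derivative g u) (at u within ?D))"
    if t: "t \<in> ?D" for t
  proof (cases "t < 0")
    case True
    then have tJ: "t \<in> J" using t by (auto simp: history_domain_def)
    have D_neg: "?D \<inter> {..<0} = J \<inter> {..<0}" by (auto simp: history_domain_def)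
    have at_neg: "at u within ?D = at u within J" if "u < 0" for u
      by (rule at_within_nhd[of _ "{..<0}"]) (use that D_neg in auto)
    show ?thesis
    proof (intro exI[of _ "hderiv J \<phi>"] exI[of _ "-t"] conjI ballI impI)
      show "continuous (at t within ?D) (hderiv J \<phi>)"
        using C1_continuous_on(2)[OF \<phi>] tJ at_neg[OF True] by (simp add: continuous_on_eq_continuous_within)
      fix u assume u: "u \<in> ?D" "dist u t < - t"
      then have "u < 0" by (auto simp: dist_real_def)
      then show "x' u = hderiv J \<phi> u" "(x has_vector_derivative hderiv J \<phi> u) (at u within ?D)"
        using u xJ at_neg D_neg by (auto simp: x'_def)
    qed (use True in auto)
  next
    case False
    then have t0: "0 \<le> t" "ereal t < T" using t le_0 Tpos by (auto simp: history_domain_def zero_ereal_def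
          intro: le_less_trans[OF _ Tpos[unfolded zero_ereal_def]])
    obtain \<eta> where \<eta>: "\<eta> > 0" "ereal (t + \<eta>) < T" using ereal_add_gap[OF t0(2)] .
    obtain \<delta> where \<delta>: "\<delta> > 0" "{-\<delta>..0} \<subseteq> J" using nontrivial by blast
    \<comment> \<open>With \<tau> = t + \<epsilon>, times u within \<epsilon> of t become arguments
      u - \<tau> between -2 * \<epsilon> and 0, hence interior points of \<open>J\<close>.\<close>
    define \<epsilon> where "\<epsilon> = min \<eta> (\<delta> / 2)"
    have \<epsilon>: "\<epsilon> > 0" "2 * \<epsilon> \<le> \<delta>" "\<epsilon> \<le> \<eta>" using \<eta> \<delta> by (auto simp: \<epsilon>_def)
    define \<tau> where "\<tau> = t + \<epsilon>"
    have \<tau>: "0 < \<tau>" "ereal \<tau> < T"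
      using \<eta>(2) \<epsilon>(1,3) t0(1) unfolding \<tau>_def
      by (auto intro: le_less_trans[of _ "ereal (t + \<eta>)"])
    define G where "G = segment J x \<tau>"
    define g where "g u = hderiv J G (u - \<tau>)" for u
    have G: "G \<in> C1 J" using x \<tau> U unfolding ivp_solution_iff G_def by blast
    have int: "u - \<tau> \<in> interior J" if "dist u t < \<epsilon>" for u
    proof -
      have "{-\<delta><..<0} \<subseteq> J" using \<delta>(2) by auto
      moreover have "u - \<tau> \<in> {-\<delta><..<0}" using that \<epsilon> by (auto simp: \<tau>_def dist_real_def)
      ultimately show ?thesis using interiorI[OF open_greaterThanLessThan] by blast
    qed
    have deriv: "(x has_vector_derivative g u) (at u)" if u: "dist u t < \<epsilon>" for u
    proof -
      have "(G has_vector_derivative g u) (at (u - \<tau>))"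
        using C1_imp_has_vector_derivative[OF G, of "u - \<tau>"] int[OF u] interior_subset
          at_within_interior[OF int[OF u]] unfolding g_def by fastforce
      moreover have "((\<lambda>u. u - \<tau>) has_vector_derivative 1) (at u)"
        by (auto intro!: derivative_eq_intros simp flip: has_real_derivative_iff_has_vector_derivative)
      ultimately have "(G \<circ> (\<lambda>u. u - \<tau>) has_vector_derivative 1 *\<^sub>R g u) (at u)"
        by (intro vector_diff_chain_at) auto
      then have "(G \<circ> (\<lambda>u. u - \<tau>) has_vector_derivative g u) (at u)" by simp
      then show ?thesis
      proof (rule has_vector_derivative_transform_within_open[of _ _ _ "ball t \<epsilon>"])
        fix v assume "v \<in> ball t \<epsilon>"
        then have "v - \<tau> \<in> J" using int[of v] interior_subset by (auto simp: dist_commute)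
        then show "(G \<circ> (\<lambda>u. u - \<tau>)) v = x v" by (simp add: G_def segment_def)
      qed (use u in \<open>auto simp: dist_commute\<close>)
    qed
    \<comment> \<open>For u < 0 the derivative of the history within \<open>J\<close> meets the
      two-sided derivative of x; they agree because derivatives within \<open>J\<close> are
      unique.\<close>
    have eq: "x' u = g u" if u: "u \<in> ?D" "dist u t < \<epsilon>" for u
    proof (cases "u < 0")
      case True
      then have uJ: "u \<in> J" using u by (auto simp: history_domain_def)
      have "hderiv J x u = hderiv J \<phi> u" using hderiv_eqI[OF uJ xJ[OF uJ]] .
      moreover have "hderiv J x u = g u"
        using hderiv_eqI[OF uJ has_vector_derivative_at_within[OF deriv[OF u(2)]]] .
      ultimately show ?thesis using True by (simp add: x'_def)
    next
      case False
      then show ?thesis using vector_derivative_at[OF deriv[OF u(2)]] by (simp add: x'_def)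
    qed
    have "continuous_on (interior J) (hderiv J G)"
      using C1_continuous_on(2)[OF G] interior_subset continuous_on_subset by blast
    then have "isCont (hderiv J G) (t - \<tau>)"
      using int[of t] \<epsilon>(1) by (simp add: continuous_on_eq_continuous_at)
    moreover have "isCont (\<lambda>u. u - \<tau>) t" by (intro continuous_intros)
    ultimately have "isCont g t"
      unfolding g_def using isCont_o2[where f = "\<lambda>u. u - \<tau>"] by blast
    then have "continuous (at t within ?D) g" by (rule continuous_at_imp_continuous_within)
    then show ?thesis
      using \<epsilon>(1) eq has_vector_derivative_at_within[OF deriv] by blast
  qed
  have path: "C1_path J T x x'"
    unfolding C1_path_def
  proof (intro conjI ballI)
    fix t assume t: "t \<in> ?D"
    show "(x has_vector_derivative x' t) (at t within ?D)" using local[OF t] t by (metis dist_self)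
  next
    show "continuous_on ?D x'"
      unfolding continuous_on_eq_continuous_within
    proof
      fix t assume t: "t \<in> ?D"
      obtain g \<epsilon> where "\<epsilon> > 0" "continuous (at t within ?D) g"
          "\<And>u. u \<in> ?D \<Longrightarrow> dist u t < \<epsilon> \<Longrightarrow> g u = x' u"
        using local[OF t] by metis
      then show "continuous (at t within ?D) x'"
        using continuous_transform_within[of t ?D g \<epsilon> x'] t by blast
    qed
  qed
  show ?thesis
  proof (rule that[OF path])
    show "\<forall>t. 0 < t \<and> ereal t < T \<longrightarrow> x' t = f (segment J x t)"
      using x vector_derivative_at unfolding ivp_solution_iff x'_def by auto
    show "\<forall>s\<in>J. x' s = hderiv J \<phi> s"
      using C1_path_segment(2)[OF path order_refl] Tpos x0 by (simp add: zero_ereal_def)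
  qed
qed

end

section \<open>Uniqueness and the semiflow\<close>

context delay_equation
begin

text \<open>At the infimum t0 of the times of disagreement the segments still agree. On a short
  interval after t0 the Lipschitz estimate involves only the maximum of norm (x - y), and
  integration bounds this maximum by half of itself.\<close>

lemma ivp_solution_unique:
  assumes \<phi>: "\<phi> \<in> U" and x: "ivp_solution J U f \<phi> T x" and y: "ivp_solution J U f \<phi> T y"
    and t: "t \<in> history_domain J T"
  shows "x t = y t"
proof (rule ccontr)
  assume neq: "x t \<noteq> y t"
  have x0: "segment J x 0 = \<phi>" and y0: "segment J y 0 = \<phi>"
    using x y unfolding ivp_solution_iff by auto
  have xJ: "x s = y s" if "s \<in> J" for s
    using segment_0_eqD[OF x0 that] segment_0_eqD[OF y0 that] by simp
  have t0T: "0 \<le> t" "ereal t < T" using t xJ neq by (auto simp: history_domain_def)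
  have less_T: "ereal u < T" if "u \<le> t" for u
    using that t0T(2) by (meson ereal_less_eq(3) le_less_trans)
  have \<phi>1: "\<phi> \<in> C1 J" using \<phi> U_subset by blast
  obtain x' where px: "C1_path J T x x'"
    and x': "\<forall>t. 0 < t \<and> ereal t < T \<longrightarrow> x' t = f (segment J x t)"
    and "\<forall>s\<in>J. x' s = hderiv J \<phi> s"
    using ivp_solution_C1_path[OF x \<phi>1 U_subset] .
  obtain y' where py: "C1_path J T y y'"
    and y': "\<forall>t. 0 < t \<and> ereal t < T \<longrightarrow> y' t = f (segment J y t)"
    and "\<forall>s\<in>J. y' s = hderiv J \<phi> s"
    using ivp_solution_C1_path[OF y \<phi>1 U_subset] .
  define z where "z u = x u - y u" for u
  have z: "(z has_vector_derivative x' u - y' u) (at u)" if "0 \<le> u" "ereal u < T" for u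
    unfolding z_def using C1_path_at[OF px that] C1_path_at[OF py that]
    by (rule has_vector_derivative_diff)
  define A where "A = {u \<in> {0..t}. x u \<noteq> y u}"
  have A: "t \<in> A" "bdd_below A" using neq t0T by (auto simp: A_def intro: bdd_belowI[of _ 0])
  define t0 where "t0 = Inf A"
  have "t0 \<le> t" unfolding t0_def using cInf_lower[OF A] .
  moreover have "0 \<le> t0"
    unfolding t0_def by (rule cInf_greatest) (use A(1) in \<open>auto simp: A_def\<close>)
  ultimately have t0: "0 \<le> t0" "t0 \<le> t" by auto
  have before: "x u = y u" if "0 \<le> u" "u < t0" for u
  proof (rule ccontr)
    assume "x u \<noteq> y u"
    then have "u \<in> A" using that t0 by (simp add: A_def)
    then show False using cInf_lower[OF _ A(2)] that(2) unfolding t0_def by fastforce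
  qed
  \<comment> \<open>The infimum itself is a time of agreement: by continuity from the left, or as
    part of the history if t0 = 0.\<close>
  have at_t0: "x t0 = y t0"
  proof (cases "t0 = 0")
    case False
    have "(z \<longlongrightarrow> z t0) (at_left t0)"
      using has_vector_derivative_continuous[OF z[OF t0(1) less_T[OF t0(2)]]]
      by (meson continuous_at_imp_continuous_within continuous_within)
    moreover have "(z \<longlongrightarrow> 0) (at_left t0)"
    proof (rule tendsto_eventually)
      show "\<forall>\<^sub>F u in at_left t0. z u = 0"
        using before t0(1) False by (intro eventually_at_leftI[of 0]) (auto simp: z_def)
    qed
    ultimately have "z t0 = 0" using tendsto_unique trivial_limit_at_left_real by blast
    then show ?thesis by (simp add: z_def)
  qed (use xJ zero_mem in simp)
  have upto: "x u = y u" if "u \<in> J \<or> 0 \<le> u \<and> u \<le> t0" for u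
    using that xJ before at_t0 by (cases "u = t0") auto
  have past: "u + s \<in> J \<or> 0 \<le> u + s" if "0 \<le> u" "s \<in> J" for u s
    using between_mem[OF that(2), of "u + s"] that(1) by auto
  have "x (t0 + s) = y (t0 + s)" if "s \<in> J" for s
    using upto[of "t0 + s"] past[OF t0(1) that] that le_0 by auto
  then have seg: "segment J y t0 = segment J x t0" by (auto simp: segment_def)
  have "segment J x t0 \<in> U"
    using x t0 \<phi> x0 less_T[OF t0(2)] unfolding ivp_solution_iff by (cases "t0 = 0") auto
  from locally_lipschitz[OF this] obtain O' K L where O': "openin (C1_top J) O'" "segment J x t0 \<in> O'"
    and K: "K \<subseteq> J" and L: "L > 0"
    and lip: "\<And>\<psi> \<omega> e. \<psi> \<in> O' \<Longrightarrow> \<omega> \<in> O' \<Longrightarrow> e > 0 \<Longrightarrow>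
       (\<And>s. s \<in> K \<Longrightarrow> norm (\<omega> s - \<psi> s) \<le> e) \<Longrightarrow> norm (f \<omega> - f \<psi>) \<le> L * e"
    by metis
  obtain \<eta>1 where \<eta>1: "\<eta>1 > 0" "ereal (t0 + \<eta>1) < T"
    and O1: "\<forall>u. 0 \<le> u \<and> t0 - \<eta>1 \<le> u \<and> u \<le> t0 + \<eta>1 \<longrightarrow> segment J x u \<in> O'"
    using segment_continuous[OF px t0(1) less_T[OF t0(2)] O'] .
  obtain \<eta>2 where \<eta>2: "\<eta>2 > 0"
    and O2: "\<forall>u. 0 \<le> u \<and> t0 - \<eta>2 \<le> u \<and> u \<le> t0 + \<eta>2 \<longrightarrow> segment J y u \<in> O'"
    using segment_continuous[OF py t0(1) less_T[OF t0(2)] O'(1)] O'(2) seg by auto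
  \<comment> \<open>The first two bounds keep both segments in the neighbourhood with Lipschitz
    constant L; the third gives L * \<eta> \<le> 1 / 2.\<close>
  define \<eta> where "\<eta> = min (min \<eta>1 \<eta>2) (1 / (2 * L))"
  have \<eta>: "\<eta> > 0" "\<eta> \<le> \<eta>1" "\<eta> \<le> \<eta>2" "\<eta> \<le> 1 / (2 * L)" using \<eta>1 \<eta>2 L by (auto simp: \<eta>_def)
  then have L\<eta>: "L * \<eta> \<le> 1 / 2" using L by (simp add: field_simps)
  have T: "ereal u < T" if "u \<le> t0 + \<eta>" for u
  proof -
    have "ereal u \<le> ereal (t0 + \<eta>1)" using that \<eta>(2) by simp
    then show ?thesis using \<eta>1(2) by (rule le_less_trans)
  qed
  have cont: "continuous_on {t0..t0 + \<eta>} z"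
    using has_vector_derivative_continuous[OF z] t0 T
    by (intro continuous_at_imp_continuous_on) auto
  have "{t0..t0 + \<eta>} \<noteq> {}" using \<eta>(1) by simp
  from continuous_attains_sup[OF compact_Icc this continuous_on_norm[OF cont]]
  obtain m where m: "m \<in> {t0..t0 + \<eta>}" "\<And>u. u \<in> {t0..t0 + \<eta>} \<Longrightarrow> norm (z u) \<le> norm (z m)"
    by blast
  have "norm (z m) = 0"
  proof (rule ccontr)
    assume "norm (z m) \<noteq> 0"
    then have M: "norm (z m) > 0" by simp
    then have "m \<noteq> t0" using at_t0 by (auto simp: z_def)
    then have "t0 < m" using m(1) by simp
    have bound: "norm (x' u - y' u) \<le> L * norm (z m)" if u: "t0 < u" "u < m" for u
    proof -
      have "norm (f (segment J x u) - f (segment J y u)) \<le> L * norm (z m)"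
      proof (rule lip[OF _ _ M])
        show "segment J y u \<in> O'" using O2 t0 u m(1) \<eta> by simp
        show "segment J x u \<in> O'" using O1 t0 u m(1) \<eta> by simp
        fix s assume "s \<in> K"
        then have sJ: "s \<in> J" using K by blast
        \<comment> \<open>The difference vanishes up to t0, and every later argument u + s lies
          between t0 and m, where the maximum dominates.\<close>
        have "norm (z (u + s)) \<le> norm (z m)"
        proof (cases "u + s \<in> J \<or> u + s \<le> t0")
          case True
          then have "z (u + s) = 0" using upto[of "u + s"] past[of u s] sJ u t0 by (auto simp: z_def)
          then show ?thesis by simp
        next
          case False
          then show ?thesis using m u sJ le_0 by (intro m(2)) auto
        qed
        then show "norm (segment J x u s - segment J y u s) \<le> norm (z m)"
          using sJ by (simp add: segment_def z_def)
      qed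
      then show ?thesis using spec[OF x', of u] spec[OF y', of u] u t0 m(1) T[of u] by simp
    qed
    have "norm (z m - z t0) \<le> L * norm (z m) * m - L * norm (z m) * t0"
    proof (rule differentiable_bound_general[OF \<open>t0 < m\<close>])
      show "continuous_on {t0..m} z" using cont m(1) by (auto intro: continuous_on_subset)
      show "continuous_on {t0..m} (\<lambda>u. L * norm (z m) * u)"
        by (intro continuous_on_mult_left continuous_on_id)
      show "((\<lambda>u. L * norm (z m) * u) has_vector_derivative L * norm (z m)) (at u)" for u
        by (auto intro!: derivative_eq_intros simp flip: has_real_derivative_iff_has_vector_derivative)
      show "(z has_vector_derivative x' u - y' u) (at u)" if "t0 < u" "u < m" for u
        using z t0 T m(1) that by simp
    qed (use bound in auto)
    also have "\<dots> = (L * (m - t0)) * norm (z m)" by (simp add: algebra_simps)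
    also have "\<dots> \<le> (L * \<eta>) * norm (z m)"
      using m(1) L by (intro mult_right_mono mult_left_mono) auto
    also have "\<dots> \<le> 1 / 2 * norm (z m)" using L\<eta> by (intro mult_right_mono) auto
    finally show False using M at_t0 by (simp add: z_def)
  qed
  then have "x u = y u" if "u \<in> {t0..t0 + \<eta>}" for u
    using m(2)[OF that] by (simp add: z_def)
  moreover obtain a where "a \<in> A" "a < t0 + \<eta>"
    using cInf_lessD[of A "t0 + \<eta>"] A(1) \<eta>(1) unfolding t0_def by auto
  moreover have "t0 \<le> a" using cInf_lower[OF \<open>a \<in> A\<close> A(2)] by (simp add: t0_def)
  ultimately show False by (auto simp: A_def)
qed

text \<open>Solutions with different lifetimes agree on the shorter interval, so the description
  behind \<open>THE\<close> has exactly one value and any solution at hand computes it.\<close>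

lemma max_solution_eq:
  assumes \<phi>: "\<phi> \<in> U" and x: "ivp_solution J U f \<phi> T x" and t: "t \<in> history_domain J T"
  shows "max_solution J U f \<phi> t = x t"
  unfolding max_solution_def
proof (rule the_equality)
  have T: "0 < T" using x unfolding ivp_solution_iff by simp
  have tT: "ereal t < T"
  proof (cases "t \<le> 0")
    case True
    then have "ereal t \<le> 0" by (simp add: zero_ereal_def)
    then show ?thesis using T by (rule le_less_trans)
  qed (use t le_0 in \<open>auto simp: history_domain_def\<close>)
  show "\<exists>T x'. ereal t < T \<and> ivp_solution J U f \<phi> T x' \<and> x t = x' t" using tT x by blast
  fix v assume "\<exists>T x. ereal t < T \<and> ivp_solution J U f \<phi> T x \<and> v = x t"
  then obtain T' y where y: "ereal t < T'" "ivp_solution J U f \<phi> T' y" "v = y t" by blast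
  have "0 < T'" using y(2) unfolding ivp_solution_iff by simp
  then have "ivp_solution J U f \<phi> (min T T') x" "ivp_solution J U f \<phi> (min T T') y"
    using ivp_solution_mono[OF x] ivp_solution_mono[OF y(2)] T by (auto simp: min_less_iff_conj)
  moreover have "t \<in> history_domain J (min T T')"
    using t tT y(1) by (auto simp: history_domain_def)
  ultimately show "v = x t" using ivp_solution_unique[OF \<phi>] y(3) by metis
qed

lemma semiflow_eq:
  assumes "\<phi> \<in> U" "ivp_solution J U f \<phi> T x" "0 \<le> t" "ereal t < T"
  shows "semiflow J U f t \<phi> = segment J x t"
  using max_solution_eq[OF assms(1,2)] add_mem_history_domain[OF assms(3,4)]
  by (auto simp: semiflow_def segment_def)

lemma less_t_maxE:
  assumes "ereal t < t_max J U f \<phi>"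
  obtains T x where "ivp_solution J U f \<phi> T x" "ereal t < T"
  using assms unfolding t_max_def less_Sup_iff by blast

lemma ivp_solution_less_t_max: "ivp_solution J U f \<phi> T x \<Longrightarrow> ereal t < T \<Longrightarrow> ereal t < t_max J U f \<phi>"
  unfolding t_max_def less_Sup_iff by blast

text \<open>Near each positive time the maximal solution coincides with a single solution. Global
  existence in (I) is stated as membership in the domain of the semiflow; this turns it into a
  solution.\<close>

lemma ivp_solution_max_solution:
  assumes \<phi>: "\<phi> \<in> U" and inf: "\<And>t. 0 \<le> t \<Longrightarrow> ereal t < t_max J U f \<phi>"
  shows "ivp_solution J U f \<phi> \<infinity> (max_solution J U f \<phi>)"
  unfolding ivp_solution_iff
proof (intro conjI allI impI)
  let ?x = "max_solution J U f \<phi>"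
  show "segment J ?x 0 = \<phi>"
  proof -
    obtain T x where x: "ivp_solution J U f \<phi> T x" "ereal 0 < T" using less_t_maxE inf by blast
    have "segment J ?x 0 = segment J x 0"
      using semiflow_eq[OF \<phi> x(1) order_refl x(2)] by (simp add: semiflow_def)
    then show ?thesis using x(1) unfolding ivp_solution_iff by simp
  qed
  fix t assume t: "0 < t \<and> ereal t < \<infinity>"
  obtain T x where x: "ivp_solution J U f \<phi> T x" "ereal t < T"
    using less_t_maxE inf t by (metis less_imp_le)
  have seg: "segment J ?x t = segment J x t"
    using semiflow_eq[OF \<phi> x(1) _ x(2)] t by (simp add: semiflow_def)
  then show "segment J ?x t \<in> U" using x t unfolding ivp_solution_iff by simp
  obtain \<eta> where \<eta>: "\<eta> > 0" "ereal (t + \<eta>) < T" using ereal_add_gap[OF x(2)] .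
  have "(x has_vector_derivative f (segment J ?x t)) (at t)"
    using x t seg unfolding ivp_solution_iff by simp
  then show "(?x has_vector_derivative f (segment J ?x t)) (at t)"
  proof (rule has_vector_derivative_transform_within_open[of _ _ _ "{0<..<t + \<eta>}"])
    fix u assume u: "u \<in> {0<..<t + \<eta>}"
    then have "ereal u \<le> ereal (t + \<eta>)" by simp
    then have "ereal u < T" using \<eta>(2) by (rule le_less_trans)
    then show "x u = ?x u"
      using max_solution_eq[OF \<phi> x(1), of u] u by (simp add: history_domain_def)
  qed (use t \<eta> in auto)
qed simp

end

lemma history_interval_half_line: "history_interval {..0}"
  by standard (auto simp: is_interval_1 intro: exI[of _ 1])

lemma history_interval_compact: "d > 0 \<Longrightarrow> history_interval {-d..0}"
  by standard (auto simp: is_interval_cc intro: exI[of _ d])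

lemma history_domain_half_line [simp]: "history_domain {..0} \<infinity> = UNIV"
  by (auto simp: history_domain_def)

text \<open>The sum of the half-lines is the whole line, so the derivative is two-sided, and here
  the equation is posed at t = 0 too.\<close>

lemma solution_on_half_line_iff:
  "solution_on {..0} U f {0..} x \<longleftrightarrow> (\<forall>t\<ge>0. segment {..0} x t \<in> U \<and>
     (x has_vector_derivative f (segment {..0} x t)) (at t))"
proof -
  have "v \<in> {s + t' |s t'. s \<in> {..0} \<and> t' \<in> {0..}}" for v :: real
    by (intro CollectI exI[of _ "min v 0"] exI[of _ "max v 0"]) auto
  then have "{s + t' |s t'. s \<in> {..0} \<and> t' \<in> {0..}} = (UNIV :: real set)" by blast
  then show ?thesis unfolding solution_on_def by auto
qed

section \<open>Restriction to a compact history interval\<close>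

lemma restr_segment: "restr d (segment {..0} x t) = segment {-d..0} x t"
  by (auto simp: restr_def segment_def)

lemma restr_C1:
  assumes d: "d > 0" and \<phi>: "\<phi> \<in> C1 {..0}"
  shows "restr d \<phi> \<in> C1 {-d..0}"
    and "s \<in> {-d..0} \<Longrightarrow> hderiv {-d..0} (restr d \<phi>) s = hderiv {..0} \<phi> s"
proof -
  interpret history_interval "{-d..0}" using history_interval_compact[OF d] .
  have D: "(restr d \<phi> has_vector_derivative hderiv {..0} \<phi> s) (at s within {-d..0})"
    if s: "s \<in> {-d..0}" for s
  proof -
    have "(\<phi> has_vector_derivative hderiv {..0} \<phi> s) (at s within {-d..0})"
      using has_vector_derivative_within_subset[OF C1_imp_has_vector_derivative[OF \<phi>], of s "{-d..0}"] s
      by auto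
    then show ?thesis
      by (rule has_vector_derivative_transform_within[OF _ zero_less_one s]) (simp add: restr_def)
  qed
  show "s \<in> {-d..0} \<Longrightarrow> hderiv {-d..0} (restr d \<phi>) s = hderiv {..0} \<phi> s"
    using D hderiv_eqI by blast
  have "continuous_on {-d..0} (hderiv {..0} \<phi>)"
    using C1_continuous_on(2)[OF \<phi>] by (auto intro: continuous_on_subset)
  then show "restr d \<phi> \<in> C1 {-d..0}"
    by (intro C1I[OF D]) (auto simp: restr_def)
qed

text \<open>Continuity of restriction: a compact subset of [-d,0] is also one of the half-line, and
  on it values and derivatives are unchanged.\<close>

lemma openin_restr_vimage:
  fixes G :: "(real \<Rightarrow> real^'n) set"
  assumes d: "d > 0" and G: "openin (C1_top {-d..0}) G"
  shows "openin (C1_top {..0}) {\<phi> \<in> C1 {..0}. restr d \<phi> \<in> G}"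
proof (subst openin_subopen, intro ballI)
  fix \<phi> assume "\<phi> \<in> {\<phi> \<in> C1 {..0}. restr d \<phi> \<in> G}"
  then have \<phi>: "\<phi> \<in> C1 {..0}" "restr d \<phi> \<in> G" by auto
  obtain K \<epsilon> where K: "compact K" "K \<subseteq> {-d..0}" "\<epsilon> > 0" "C1_ball {-d..0} K \<epsilon> (restr d \<phi>) \<subseteq> G"
    using openin_C1_topE[OF G \<phi>(2)] .
  have "restr d \<psi> \<in> C1_ball {-d..0} K \<epsilon> (restr d \<phi>)" if \<psi>: "\<psi> \<in> C1_ball {..0} K \<epsilon> \<phi>" for \<psi>
  proof -
    have \<psi>1: "\<psi> \<in> C1 {..0}" using \<psi> by (simp add: C1_ball_def)
    have "restr d \<psi> s = \<psi> s" "restr d \<phi> s = \<phi> s"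
      "hderiv {-d..0} (restr d \<psi>) s = hderiv {..0} \<psi> s"
      "hderiv {-d..0} (restr d \<phi>) s = hderiv {..0} \<phi> s" if "s \<in> K" for s
      using that K(2) restr_C1(2)[OF d \<psi>1, of s] restr_C1(2)[OF d \<phi>(1), of s] by (auto simp: restr_def)
    then show ?thesis using \<psi> restr_C1(1)[OF d \<psi>1] by (simp add: C1_ball_def)
  qed
  then have "C1_ball {..0} K \<epsilon> \<phi> \<subseteq> {\<phi> \<in> C1 {..0}. restr d \<phi> \<in> G}"
    using K(4) by (auto simp: C1_ball_def)
  moreover have "openin (C1_top {..0}) (C1_ball {..0} K \<epsilon> \<phi>)"
    using K by (intro openin_C1_ball \<phi>) auto
  ultimately show "\<exists>T. openin (C1_top {..0}) T \<and> \<phi> \<in> T \<and> T \<subseteq> {\<phi> \<in> C1 {..0}. restr d \<phi> \<in> G}"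
    using centre_in_C1_ball[OF \<phi>(1) K(3)] by blast
qed

lemma norm_d1_diff_le:
  fixes \<phi> \<psi> :: "real \<Rightarrow> real^'n"
  assumes d: "d > 0" and C: "\<phi> \<in> C1 {-d..0}" "\<psi> \<in> C1 {-d..0}"
    and le: "\<And>s. s \<in> {-d..0} \<Longrightarrow> norm (\<psi> s - \<phi> s) \<le> a"
      "\<And>s. s \<in> {-d..0} \<Longrightarrow> norm (hderiv {-d..0} \<psi> s - hderiv {-d..0} \<phi> s) \<le> b"
  shows "norm_d1 d (\<psi> - \<phi>) \<le> a + b"
  unfolding norm_d1_def using d le
  by (intro add_mono cSUP_least) (auto simp: hderiv_diff(2)[OF d C])

lemma norm_d1_diff_ge:
  fixes \<phi> \<psi> :: "real \<Rightarrow> real^'n"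
  assumes d: "d > 0" and C: "\<phi> \<in> C1 {-d..0}" "\<psi> \<in> C1 {-d..0}" and s: "s \<in> {-d..0}"
  shows "norm (\<psi> s - \<phi> s) + norm (hderiv {-d..0} \<psi> s - hderiv {-d..0} \<phi> s) \<le> norm_d1 d (\<psi> - \<phi>)"
proof -
  have bdd: "bdd_above ((\<lambda>s. norm (g s)) ` {-d..0})" if "continuous_on {-d..0} g"
    for g :: "real \<Rightarrow> real^'n"
    using that by (intro bounded_imp_bdd_above compact_imp_bounded compact_continuous_image
        continuous_on_norm) auto
  have "continuous_on {-d..0} (\<lambda>s. \<psi> s - \<phi> s)"
    "continuous_on {-d..0} (\<lambda>s. hderiv {-d..0} \<psi> s - hderiv {-d..0} \<phi> s)"
    using C1_continuous_on[OF C(1)] C1_continuous_on[OF C(2)] by (auto intro!: continuous_on_diff)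
  moreover have "continuous_on {-d..0} (hderiv {-d..0} (\<psi> - \<phi>)) \<longleftrightarrow>
      continuous_on {-d..0} (\<lambda>s. hderiv {-d..0} \<psi> s - hderiv {-d..0} \<phi> s)"
    by (rule continuous_on_cong) (simp_all add: hderiv_diff(2)[OF d C])
  ultimately have "norm ((\<psi> - \<phi>) s) \<le> (SUP s\<in>{-d..0}. norm ((\<psi> - \<phi>) s))"
    "norm (hderiv {-d..0} (\<psi> - \<phi>) s) \<le> (SUP s\<in>{-d..0}. norm (hderiv {-d..0} (\<psi> - \<phi>) s))"
    using s by (auto intro!: cSUP_upper bdd simp: fun_diff_def)
  then show ?thesis unfolding norm_d1_def using hderiv_diff(2)[OF d C s] by simp
qed

section \<open>Comparison of the equation with its reduction to [-d,0]\<close>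

locale delay_reduction =
  fixes U N Ud :: "(real \<Rightarrow> real^'n) set"
    and f :: "(real \<Rightarrow> real^'n) \<Rightarrow> real^'n"
    and De De_fd :: "(real \<Rightarrow> real^'n) \<Rightarrow> (real \<Rightarrow> real^'n) \<Rightarrow> real^'n"
    and d :: real
  assumes U: "openin (C1_top {..0}) U" and De: "extended_derivative {..0} U f De"
    and N_subset: "N \<subseteq> U"
    and d: "d > 0"
    and N_delay: "\<forall>\<xi>\<in>N. \<forall>\<psi>\<in>N. (\<forall>s\<in>{-d..0}. \<xi> s = \<psi> s) \<longrightarrow> f \<xi> = f \<psi>"
    and Ud_open: "openin (C1_top {-d..0}) Ud" and extend_Ud: "extend d ` Ud \<subseteq> N"
    and De_fd: "extended_derivative {-d..0} Ud (\<lambda>\<phi>. f (extend d \<phi>)) De_fd"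
begin

sublocale full: delay_equation "{..0}" U f De
  using history_interval_half_line U De
  by (simp add: delay_equation_def delay_equation_axioms_def)

sublocale reduced: delay_equation "{-d..0}" Ud "\<lambda>\<phi>. f (extend d \<phi>)" De_fd
  using history_interval_compact[OF d] Ud_open De_fd
  by (simp add: delay_equation_def delay_equation_axioms_def)

text \<open>Both \<psi> and the extension of its restriction lie in \<open>N\<close>, the latter
  because \<open>extend\<close> maps \<open>Ud\<close> into \<open>N\<close>. They agree on [-d,0],
  which is all that \<open>f\<close> sees on \<open>N\<close>.\<close>

lemma f_extend_restr:
  assumes "\<psi> \<in> N" "restr d \<psi> \<in> Ud"
  shows "f (extend d (restr d \<psi>)) = f \<psi>"
proof -
  have "extend d (restr d \<psi>) \<in> N" using extend_Ud assms(2) by blast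
  moreover have "\<forall>s\<in>{-d..0}. extend d (restr d \<psi>) s = \<psi> s" by (simp add: extend_def restr_def)
  ultimately show ?thesis using N_delay assms(1) by blast
qed

lemma restr_solution_manifold_iff:
  assumes "\<phi> \<in> N" "restr d \<phi> \<in> Ud"
  shows "restr d \<phi> \<in> solution_manifold {-d..0} Ud (\<lambda>\<phi>. f (extend d \<phi>)) \<longleftrightarrow>
    \<phi> \<in> solution_manifold {..0} U f"
proof -
  have "\<phi> \<in> C1 {..0}" using assms(1) N_subset full.U_subset by blast
  then show ?thesis
    using assms N_subset restr_C1(2)[OF d, of \<phi> 0] d f_extend_restr[OF assms]
    by (auto simp: solution_manifold_def)
qed

lemma ivp_solution_restr:
  assumes x: "ivp_solution {..0} U f \<phi> T x"
    and N: "\<And>t. 0 < t \<Longrightarrow> ereal t < T \<Longrightarrow> segment {..0} x t \<in> N"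
    and Ud: "\<And>t. 0 < t \<Longrightarrow> ereal t < T \<Longrightarrow> restr d (segment {..0} x t) \<in> Ud"
  shows "ivp_solution {-d..0} Ud (\<lambda>\<phi>. f (extend d \<phi>)) (restr d \<phi>) T x"
  unfolding reduced.ivp_solution_iff
proof (intro conjI allI impI; (elim conjE)?)
  show "0 < T" "segment {-d..0} x 0 = restr d \<phi>"
    using x unfolding full.ivp_solution_iff by (auto simp flip: restr_segment)
  fix t assume t: "0 < t" "ereal t < T"
  show "segment {-d..0} x t \<in> Ud" using Ud[OF t] by (simp add: restr_segment)
  have "f (extend d (segment {-d..0} x t)) = f (segment {..0} x t)"
    using f_extend_restr[OF N[OF t] Ud[OF t]] by (simp add: restr_segment)
  then show "(x has_vector_derivative f (extend d (segment {-d..0} x t))) (at t)"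
    using x t unfolding full.ivp_solution_iff by simp
qed

text \<open>Along an orbit in \<open>V\<close> with restrictions in \<open>Ud\<close> the right-hand
  sides coincide, so the restricted orbit is one of the reduced semiflow. If it also stays in
  \<open>Vd\<close>, it stays in \<open>M\<close>.\<close>

lemma locally_positively_invariant_lift:
  assumes V: "openin (C1_top {..0}) V" "p \<in> V" "V \<subseteq> N"
    and M: "M \<subseteq> solution_manifold {-d..0} Ud (\<lambda>\<phi>. f (extend d \<phi>))" "restr d p \<in> M"
    and inv: "locally_positively_invariant (C1_top {-d..0})
      (semiflow_domain {-d..0} Ud (\<lambda>\<phi>. f (extend d \<phi>)))
      (semiflow {-d..0} Ud (\<lambda>\<phi>. f (extend d \<phi>))) (restr d p) M"
  shows "locally_positively_invariant (C1_top {..0}) (semiflow_domain {..0} U f)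
    (semiflow {..0} U f) p {\<phi> \<in> V. restr d \<phi> \<in> M}"
proof -
  let ?fd = "\<lambda>\<phi>. f (extend d \<phi>)"
  obtain Vd where Vd: "openin (C1_top {-d..0}) Vd" "restr d p \<in> Vd"
    and Vd_inv: "\<And>t u s. (t, u) \<in> semiflow_domain {-d..0} Ud ?fd \<Longrightarrow> u \<in> M \<Longrightarrow>
      (\<And>s. s \<in> {0..t} \<Longrightarrow> semiflow {-d..0} Ud ?fd s u \<in> Vd) \<Longrightarrow> s \<in> {0..t} \<Longrightarrow>
      semiflow {-d..0} Ud ?fd s u \<in> M"
    using inv unfolding locally_positively_invariant_def by fast
  define W where "W = V \<inter> {\<phi> \<in> C1 {..0}. restr d \<phi> \<in> Vd \<inter> Ud}"
  have W: "openin (C1_top {..0}) W"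
    unfolding W_def by (intro openin_Int V openin_restr_vimage[OF d] Vd Ud_open)
  have MUd: "M \<subseteq> Ud" using M(1) by (auto simp: solution_manifold_def)
  have V_C1: "V \<subseteq> C1 {..0}" using V N_subset full.U_subset by blast
  have pW: "p \<in> W" using V Vd M(2) MUd V_C1 by (auto simp: W_def)
  show ?thesis
    unfolding locally_positively_invariant_def
  proof (intro exI[of _ W] conjI W pW ballI, clarify)
    fix t u s
    assume tu: "(t, u) \<in> semiflow_domain {..0} U f" and u: "u \<in> V" "restr d u \<in> M"
      and orbit: "\<forall>s\<in>{0..t}. semiflow {..0} U f s u \<in> W" and s: "s \<in> {0..t}"
    have uU: "u \<in> U" using u V N_subset by blast
    have t: "0 \<le> t" "ereal t < t_max {..0} U f u" using tu by (auto simp: semiflow_domain_def)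
    obtain T x where x: "ivp_solution {..0} U f u T x" "ereal t < T"
      using full.less_t_maxE[OF t(2)] .
    have less_T: "ereal r < T" if "r \<le> t" for r
      using that x(2) by (meson ereal_less_eq(3) le_less_trans)
    have flow: "semiflow {..0} U f r u = segment {..0} x r" if "r \<in> {0..t}" for r
      using full.semiflow_eq[OF uU x(1)] less_T that by auto
    obtain x' where path: "C1_path {..0} T x x'"
      by (rule full.ivp_solution_C1_path[OF x(1) subsetD[OF full.U_subset uU] full.U_subset]) (rule that)
    \<comment> \<open>The orbit piece is controlled on the closed interval [0,t], but t has to lie
      strictly below the lifetime of the restricted solution. Openness of \<open>W\<close> extends
      the control to t + \<eta>.\<close>
    have "segment {..0} x t \<in> W" using orbit flow t(1) by force
    from full.segment_continuous[OF path t(1) x(2) W this]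
    obtain \<eta> where \<eta>: "\<eta> > 0" "ereal (t + \<eta>) < T"
      and near: "\<forall>r. 0 \<le> r \<and> t - \<eta> \<le> r \<and> r \<le> t + \<eta> \<longrightarrow> segment {..0} x r \<in> W" .
    have inW: "segment {..0} x r \<in> W" if "0 \<le> r" "r \<le> t + \<eta>" for r
      using that orbit flow near \<eta>(1) by (cases "r \<le> t") (force, simp)
    have "ivp_solution {..0} U f u (ereal (t + \<eta>)) x"
      using full.ivp_solution_mono[OF x(1)] \<eta> t(1) by (simp add: zero_ereal_def)
    then have y: "ivp_solution {-d..0} Ud ?fd (restr d u) (ereal (t + \<eta>)) x"
      by (rule ivp_solution_restr) (use inW V(3) in \<open>auto simp: W_def\<close>)
    have uM: "restr d u \<in> Ud" "restr d u \<in> solution_manifold {-d..0} Ud ?fd" using u M MUd by auto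
    have flow_d: "semiflow {-d..0} Ud ?fd r (restr d u) = restr d (segment {..0} x r)"
      if "r \<in> {0..t}" for r
      using reduced.semiflow_eq[OF uM(1) y, of r] that \<eta>(1) by (simp add: restr_segment)
    have "ereal t < t_max {-d..0} Ud ?fd (restr d u)"
      using reduced.ivp_solution_less_t_max[OF y] \<eta>(1) by simp
    then have "(t, restr d u) \<in> semiflow_domain {-d..0} Ud ?fd"
      using uM t(1) by (simp add: semiflow_domain_def)
    then have "semiflow {-d..0} Ud ?fd s (restr d u) \<in> M"
      using u(2) _ s
    proof (rule Vd_inv)
      fix r assume r: "r \<in> {0..t}"
      then show "semiflow {-d..0} Ud ?fd r (restr d u) \<in> Vd"
        using inW[of r] \<eta>(1) by (simp add: flow_d W_def)
    qed
    then show "semiflow {..0} U f s u \<in> V \<and> restr d (semiflow {..0} U f s u) \<in> M"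
      using flow[OF s] flow_d[OF s] inW[of s] s \<eta>(1) by (simp add: W_def)
  qed
qed

text \<open>History and reduced solution overlap on [-d,0], so the glued curve is continuously
  differentiable on two open half-lines that cover the line. Its derivative is still the reduced
  right-hand side; the full equation has to wait until the segments are known to lie in
  \<open>N\<close>.\<close>

lemma lifted_path:
  assumes y: "ivp_solution {-d..0} Ud (\<lambda>\<phi>. f (extend d \<phi>)) (restr d \<phi>) \<infinity> y"
    and \<phi>: "\<phi> \<in> C1 {..0}" "restr d \<phi> \<in> solution_manifold {-d..0} Ud (\<lambda>\<phi>. f (extend d \<phi>))"
  obtains x x' where "C1_path {..0} \<infinity> x x'" "segment {..0} x 0 = \<phi>"
    "\<forall>t\<ge>0. segment {-d..0} x t = segment {-d..0} y t"
    "\<forall>t\<ge>0. x' t = f (extend d (segment {-d..0} y t))"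
proof -
  have Ud1: "restr d \<phi> \<in> C1 {-d..0}" using \<phi>(2) reduced.U_subset by (auto simp: solution_manifold_def)
  obtain y' where path: "C1_path {-d..0} \<infinity> y y'"
    and y': "\<forall>t. 0 < t \<and> ereal t < \<infinity> \<longrightarrow> y' t = f (extend d (segment {-d..0} y t))"
    and y'J: "\<forall>s\<in>{-d..0}. y' s = hderiv {-d..0} (restr d \<phi>) s"
    using reduced.ivp_solution_C1_path[OF y Ud1 reduced.U_subset] .
  have y0: "segment {-d..0} y 0 = restr d \<phi>" using y unfolding reduced.ivp_solution_iff by simp
  define x where "x t = (if t \<le> 0 then \<phi> t else y t)" for t
  define x' where "x' t = (if t \<le> 0 then hderiv {..0} \<phi> t else y' t)" for t
  have D: "history_domain {-d..0} \<infinity> = {-d..}" using d by (auto simp: history_domain_def)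
  have xy: "x t = y t" "x' t = y' t" if "-d \<le> t" for t
    using that segment_0_eqD[OF y0, of t] y'J restr_C1(2)[OF d \<phi>(1), of t]
    by (auto simp: x_def x'_def restr_def)
  have deriv: "(x has_vector_derivative x' t) (at t)" for t
  proof (cases "t < 0")
    case True
    have "t \<in> interior {..0}" using True by (intro interiorI[of "{..<0}"]) auto
    then have "(\<phi> has_vector_derivative x' t) (at t)"
      using C1_imp_has_vector_derivative[OF \<phi>(1), of t] True at_within_interior[of t "{..0}"]
      by (simp add: x'_def)
    then show ?thesis
      by (rule has_vector_derivative_transform_within_open[of _ _ _ "{..<0}"])
        (use True in \<open>auto simp: x_def\<close>)
  next
    case False
    have "t \<in> interior {-d..}" using False d by (intro interiorI[of "{-d<..}"]) auto
    moreover have "(y has_vector_derivative y' t) (at t within {-d..})"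
      using path False d by (simp add: C1_path_def D)
    ultimately have "(y has_vector_derivative x' t) (at t)"
      using at_within_interior[of t "{-d..}"] xy(2)[of t] False d by simp
    then show ?thesis
      by (rule has_vector_derivative_transform_within_open[of _ _ _ "{-d<..}"])
        (use False d xy in auto)
  qed
  have "continuous_on {..<0} x' \<longleftrightarrow> continuous_on {..<0} (hderiv {..0} \<phi>)"
    by (rule continuous_on_cong) (auto simp: x'_def)
  moreover have "continuous_on {..<0} (hderiv {..0} \<phi>)"
    using C1_continuous_on(2)[OF \<phi>(1)] by (auto intro: continuous_on_subset)
  moreover have "continuous_on {-d<..} x' \<longleftrightarrow> continuous_on {-d<..} y'"
    by (rule continuous_on_cong) (auto simp: xy)
  moreover have "continuous_on {-d<..} y'"
    using path unfolding C1_path_def D by (auto intro: continuous_on_subset)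
  ultimately have "continuous_on ({..<0} \<union> {-d<..}) x'"
    by (intro continuous_on_open_Un) auto
  moreover have "{..<0} \<union> {-d<..} = UNIV" using d by auto
  ultimately have xpath: "C1_path {..0} \<infinity> x x'"
    using deriv by (simp add: C1_path_def)
  show ?thesis
  proof (rule that[OF xpath])
    show "segment {..0} x 0 = \<phi>"
      using \<phi>(1) by (auto simp: segment_def x_def C1_def Cont_def)
    show "\<forall>t\<ge>0. segment {-d..0} x t = segment {-d..0} y t"
      using xy(1) by (auto simp: segment_def fun_eq_iff)
    \<comment> \<open>At t = 0 the derivative comes from the history, and membership in the reduced
      solution manifold makes the equation hold there.\<close>
    have "x' 0 = f (extend d (restr d \<phi>))"
      using \<phi>(2) restr_C1(2)[OF d \<phi>(1), of 0] d by (simp add: x'_def solution_manifold_def)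
    then show "\<forall>t\<ge>0. x' t = f (extend d (segment {-d..0} y t))"
      using y' y0 by (auto simp: x'_def)
  qed
qed

end

section \<open>Solutions near a constant history\<close>

lemma constant_hderiv:
  fixes p :: "real \<Rightarrow> real^'n"
  assumes "\<forall>s\<le>0. p s = q" "s \<le> 0"
  shows "hderiv {..0} p s = 0"
proof -
  have "(p has_vector_derivative 0) (at s within {..0})"
    by (rule has_vector_derivative_transform_within[of "\<lambda>_. q" _ _ _ 1])
      (use assms in auto)
  then show ?thesis
    using history_interval.hderiv_eqI[OF history_interval_half_line] assms(2) by simp
qed

text \<open>The segment at time -s, evaluated at s, is the value of the solution at time 0. The
  segments at times -s and 0 are both p.\<close>

lemma stationary_point_constant:
  assumes "stationary_point (semiflow_domain {..0} U f) (semiflow {..0} U f) p" "s \<le> 0"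
  shows "p s = p 0"
proof -
  have *: "semiflow {..0} U f t p = p" if "t \<ge> 0" for t
    using assms(1) that by (simp add: stationary_point_def)
  have "p s = segment {..0} (max_solution {..0} U f p) (-s) s"
    using *[of "-s"] assms(2) by (simp add: semiflow_def)
  also have "\<dots> = segment {..0} (max_solution {..0} U f p) 0 0"
    using assms(2) by (simp add: segment_def)
  also have "\<dots> = p 0" using *[of 0] by (simp add: semiflow_def)
  finally show ?thesis .
qed

text \<open>Compact sets of arguments are bounded, and enlarging them only shrinks the ball. The
  free lower bound a is used as d, so that the ball also controls the restriction to [-d,0].\<close>

lemma openin_C1_half_lineE:
  fixes p :: "real \<Rightarrow> real^'n"
  assumes "openin (C1_top {..0}) O'" "p \<in> O'"
  obtains k \<epsilon> where "k \<ge> a" "\<epsilon> > 0" "C1_ball {..0} {-k..0} \<epsilon> p \<subseteq> O'"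
proof -
  obtain K \<epsilon> where K: "compact K" "K \<subseteq> {..0}" "\<epsilon> > 0" "C1_ball {..0} K \<epsilon> p \<subseteq> O'"
    using openin_C1_topE[OF assms] .
  obtain b where b: "\<forall>s\<in>K. norm s \<le> b" using compact_imp_bounded[OF K(1)] by (auto simp: bounded_iff)
  have "K \<subseteq> {-max a b..0}" using b K(2) by fastforce
  then have "C1_ball {..0} {-max a b..0} \<epsilon> p \<subseteq> C1_ball {..0} K \<epsilon> p"
    by (auto simp: C1_ball_def)
  then show ?thesis using that[of "max a b" \<epsilon>] K by auto
qed

text \<open>A shift by t sends [-k,0] into [-k,0] and [0,\<infinity>), which \<open>init\<close> and
  \<open>near\<close> cover. The centre is constant, hence unaffected by the shift.\<close>

lemma segment_in_C1_ball:
  fixes x :: "real \<Rightarrow> real^'n"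
  assumes x: "C1_path {..0} \<infinity> x x'" and p: "\<forall>s\<le>0. p s = q"
    and init: "segment {..0} x 0 \<in> C1_ball {..0} {-k..0} \<epsilon> p"
    and near: "\<And>u. u \<ge> 0 \<Longrightarrow> norm (x u - q) < \<epsilon> \<and> norm (x' u) < \<epsilon>" and t: "t \<ge> 0"
  shows "segment {..0} x t \<in> C1_ball {..0} {-k..0} \<epsilon> p"
  unfolding C1_ball_def
proof (intro CollectI conjI ballI)
  interpret history_interval "{..0}" using history_interval_half_line .
  note seg = C1_path_segment[OF x t] C1_path_segment(2)[OF x order_refl]
  show "segment {..0} x t \<in> C1 {..0}" using seg by simp
  fix s assume s: "s \<in> {-k..0}"
  have "norm (x (t + s) - q) < \<epsilon> \<and> norm (x' (t + s)) < \<epsilon>"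
  proof (cases "t + s < 0")
    case True
    then have "t + s \<in> {-k..0}" using s t by auto
    then have "norm (segment {..0} x 0 (t + s) - p (t + s)) < \<epsilon>"
      "norm (hderiv {..0} (segment {..0} x 0) (t + s) - hderiv {..0} p (t + s)) < \<epsilon>"
      using init by (auto simp: C1_ball_def)
    then show ?thesis
      using True seg(3)[of "t + s"] constant_hderiv[OF p, of "t + s"] p
      by (simp add: segment_def zero_ereal_def)
  qed (use near in auto)
  moreover have "p s = q" "hderiv {..0} p s = 0" using p constant_hderiv[OF p] s by auto
  ultimately show "norm (segment {..0} x t s - p s) < \<epsilon>"
    "norm (hderiv {..0} (segment {..0} x t) s - hderiv {..0} p s) < \<epsilon>"
    using s seg(2)[of s] by (simp_all add: segment_def)
qed

text \<open>The norm adds one supremum for values and one for derivatives, each over the window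
  [t-d,t]; hence the factor 2.\<close>

lemma norm_d1_restr_segment_le:
  fixes x :: "real \<Rightarrow> real^'n"
  assumes x: "C1_path {..0} \<infinity> x x'" and p: "p \<in> C1 {..0}" "\<forall>s\<le>0. p s = q"
    and d: "d > 0" and t: "t \<ge> 0"
    and le: "\<And>u. t - d \<le> u \<Longrightarrow> u \<le> t \<Longrightarrow> norm (x u - q) \<le> a \<and> norm (x' u) \<le> a"
  shows "norm_d1 d (restr d (segment {..0} x t) - restr d p) \<le> 2 * a"
proof -
  interpret history_interval "{..0}" using history_interval_half_line .
  note seg = C1_path_segment[OF x t]
  have C: "segment {..0} x t \<in> C1 {..0}" using seg by simp
  have "norm_d1 d (restr d (segment {..0} x t) - restr d p) \<le> a + a"
  proof (rule norm_d1_diff_le[OF d restr_C1(1)[OF d p(1)] restr_C1(1)[OF d C]])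
    fix s assume s: "s \<in> {-d..0}"
    then have "norm (x (t + s) - q) \<le> a \<and> norm (x' (t + s)) \<le> a" by (intro le) auto
    moreover have "p s = q" "hderiv {..0} p s = 0" using p(2) constant_hderiv[OF p(2)] s by auto
    ultimately show "norm (restr d (segment {..0} x t) s - restr d p s) \<le> a"
      "norm (hderiv {-d..0} (restr d (segment {..0} x t)) s - hderiv {-d..0} (restr d p) s) \<le> a"
      using s seg(2)[of s]
      by (simp_all add: restr_C1(2)[OF d C s] restr_C1(2)[OF d p(1) s])
        (simp add: restr_def segment_def)
  qed
  then show ?thesis by simp
qed

lemma C1_path_norm_le_norm_d1:
  fixes x :: "real \<Rightarrow> real^'n"
  assumes x: "C1_path {..0} \<infinity> x x'" and p: "p \<in> C1 {..0}" "\<forall>s\<le>0. p s = q"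
    and d: "d > 0" and t: "t \<ge> 0"
  shows "norm (x t - q) + norm (x' t) \<le> norm_d1 d (restr d (segment {..0} x t) - restr d p)"
proof -
  interpret history_interval "{..0}" using history_interval_half_line .
  note seg = C1_path_segment[OF x t]
  have C: "segment {..0} x t \<in> C1 {..0}" using seg by simp
  have 0: "0 \<in> {-d..0}" using d by simp
  show ?thesis
    using norm_d1_diff_ge[OF d restr_C1(1)[OF d p(1)] restr_C1(1)[OF d C] 0] seg(2)[of 0] d
      constant_hderiv[OF p(2), of 0] p(2)
    by (simp add: restr_C1(2)[OF d C 0] restr_C1(2)[OF d p(1) 0])
      (simp add: restr_def segment_def)
qed

section \<open>Exponential estimates carried from the reduced equation to the full one and
  back\<close>

context delay_reduction
begin

text \<open>The norm of a restricted segment dominates value and derivative at its argument 0, so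
  the decay of the reduced semiflow passes to x with the same constant \<open>c\<close>.\<close>

lemma exponential_decay_lift:
  assumes V: "openin (C1_top {..0}) V" "p \<in> V" "V \<subseteq> N" and p: "\<forall>s\<le>0. p s = q"
    and M: "M \<subseteq> solution_manifold {-d..0} Ud (\<lambda>\<phi>. f (extend d \<phi>))"
    and Wt: "openin (subtopology (C1_top {-d..0}) M) Wt" "restr d p \<in> Wt"
    and c: "c > 0" and \<gamma>: "\<gamma> > 0"
    and decay: "\<forall>\<psi>\<in>Wt. \<forall>t\<ge>0. (t, \<psi>) \<in> semiflow_domain {-d..0} Ud (\<lambda>\<phi>. f (extend d \<phi>)) \<and>
      norm_d1 d (semiflow {-d..0} Ud (\<lambda>\<phi>. f (extend d \<phi>)) t \<psi> - restr d p)
        \<le> c * exp (-\<gamma> * t) * norm_d1 d (\<psi> - restr d p)"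
  shows "\<exists>Vt. openin (C1_top {..0}) Vt \<and> p \<in> Vt \<and> Vt \<subseteq> V \<and>
    (\<forall>\<phi>\<in>Vt. restr d \<phi> \<in> M \<longrightarrow> (\<exists>x. solution_on {..0} U f {0..} x \<and> segment {..0} x 0 = \<phi> \<and>
      (\<forall>t\<ge>0. norm (x t - q) + norm (vector_derivative x (at t))
        \<le> c * exp (-\<gamma> * t) * norm_d1 d (restr d \<phi> - restr d p))))"
proof -
  let ?fd = "\<lambda>\<phi>. f (extend d \<phi>)"
  have V_C1: "V \<subseteq> C1 {..0}" using V N_subset full.U_subset by blast
  then have p1: "p \<in> C1 {..0}" using V by blast
  obtain G where G: "openin (C1_top {-d..0}) G" "Wt = G \<inter> M"
    using Wt(1) unfolding openin_subtopology by blast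
  obtain k \<epsilon> where k: "k \<ge> d" and \<epsilon>: "\<epsilon> > 0" and ball: "C1_ball {..0} {-k..0} \<epsilon> p \<subseteq> V"
    using openin_C1_half_lineE[OF V(1,2)] .
  \<comment> \<open>A history within \<delta> of p on [-k,0] has a restriction at norm distance at
    most 2 * \<delta>, and decay then gives at most 2 * c * \<delta> \<le> \<epsilon> / 2.\<close>
  define \<delta> where "\<delta> = min \<epsilon> (\<epsilon> / (4 * c))"
  have \<delta>: "\<delta> > 0" "\<delta> \<le> \<epsilon>" using \<epsilon> c by (auto simp: \<delta>_def)
  have "\<delta> \<le> \<epsilon> / (4 * c)" by (simp add: \<delta>_def)
  then have c\<delta>: "c * (2 * \<delta>) < \<epsilon>" using \<epsilon> c by (simp add: field_simps)
  define Vt where "Vt = C1_ball {..0} {-k..0} \<delta> p \<inter> {\<phi> \<in> C1 {..0}. restr d \<phi> \<in> G}"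
  have sub: "C1_ball {..0} {-k..0} \<delta> p \<subseteq> C1_ball {..0} {-k..0} \<epsilon> p"
    using \<delta>(2) by (force simp: C1_ball_def)
  show ?thesis
  proof (intro exI[of _ Vt] conjI ballI impI)
    show "openin (C1_top {..0}) Vt"
      unfolding Vt_def by (intro openin_Int openin_C1_ball openin_restr_vimage d G p1) auto
    show "p \<in> Vt" using Wt(2) G(2) p1 centre_in_C1_ball[OF p1 \<delta>(1)] by (simp add: Vt_def)
    show "Vt \<subseteq> V" using sub ball by (auto simp: Vt_def)
    fix \<phi> assume \<phi>: "\<phi> \<in> Vt" "restr d \<phi> \<in> M"
    define \<psi> where "\<psi> = restr d \<phi>"
    have \<phi>1: "\<phi> \<in> C1 {..0}" and \<phi>b: "\<phi> \<in> C1_ball {..0} {-k..0} \<delta> p" using \<phi> by (auto simp: Vt_def)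
    have \<psi>Wt: "\<psi> \<in> Wt" using \<phi> G by (simp add: Vt_def \<psi>_def)
    have \<psi>X: "\<psi> \<in> solution_manifold {-d..0} Ud ?fd" "\<psi> \<in> Ud"
      using \<phi>(2) M by (auto simp: \<psi>_def solution_manifold_def)
    define y where "y = max_solution {-d..0} Ud ?fd \<psi>"
    have y: "ivp_solution {-d..0} Ud ?fd \<psi> \<infinity> y"
      unfolding y_def using decay \<psi>Wt
      by (intro reduced.ivp_solution_max_solution \<psi>X) (auto simp: semiflow_domain_def)
    obtain x x' where path: "C1_path {..0} \<infinity> x x'" and x0: "segment {..0} x 0 = \<phi>"
      and xy: "\<forall>t\<ge>0. segment {-d..0} x t = segment {-d..0} y t"
      and x': "\<forall>t\<ge>0. x' t = ?fd (segment {-d..0} y t)"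
      using lifted_path[OF y[unfolded \<psi>_def] \<phi>1 \<psi>X(1)[unfolded \<psi>_def]] .
    have xd: "(x has_vector_derivative x' t) (at t)" if "t \<ge> 0" for t
      using full.C1_path_at[OF path that] by simp
    have dist: "norm_d1 d (\<psi> - restr d p) \<le> \<delta> + \<delta>"
      unfolding \<psi>_def
    proof (rule norm_d1_diff_le[OF d restr_C1(1)[OF d p1] restr_C1(1)[OF d \<phi>1]])
      fix s assume s: "s \<in> {-d..0}"
      then have "s \<in> {-k..0}" using k by auto
      then have "norm (\<phi> s - p s) \<le> \<delta> \<and> norm (hderiv {..0} \<phi> s - hderiv {..0} p s) \<le> \<delta>"
        using \<phi>b by (force simp: C1_ball_def)
      then show "norm (restr d \<phi> s - restr d p s) \<le> \<delta>"
          "norm (hderiv {-d..0} (restr d \<phi>) s - hderiv {-d..0} (restr d p) s) \<le> \<delta>"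
        using s by (simp_all add: restr_C1(2)[OF d \<phi>1 s] restr_C1(2)[OF d p1 s])
          (simp add: restr_def)
    qed
    have bound: "norm (x t - q) + norm (x' t) \<le> c * exp (-\<gamma> * t) * norm_d1 d (\<psi> - restr d p)"
      if t: "t \<ge> 0" for t
    proof -
      have "semiflow {-d..0} Ud ?fd t \<psi> = restr d (segment {..0} x t)"
        using xy t by (simp add: semiflow_def y_def restr_segment)
      then show ?thesis
        using C1_path_norm_le_norm_d1[OF path p1 p d t] decay \<psi>Wt t by fastforce
    qed
    have near: "norm (x t - q) < \<epsilon> \<and> norm (x' t) < \<epsilon>" if t: "t \<ge> 0" for t
    proof -
      have "c * exp (-\<gamma> * t) * norm_d1 d (\<psi> - restr d p) \<le> c * exp (-\<gamma> * t) * (2 * \<delta>)"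
        using dist c by (intro mult_left_mono) auto
      also have "\<dots> \<le> c * 1 * (2 * \<delta>)"
        using c \<delta>(1) \<gamma> t by (intro mult_right_mono mult_left_mono) auto
      finally have "norm (x t - q) + norm (x' t) < \<epsilon>" using bound[OF t] c\<delta> by simp
      then show ?thesis using norm_ge_zero[of "x t - q"] norm_ge_zero[of "x' t"] by linarith
    qed
    \<comment> \<open>The glued curve has been estimated without using the full equation; now its
      segments lie in \<open>N\<close>, and the reduced right-hand side becomes \<open>f\<close> of
      the full segment.\<close>
    have inN: "segment {..0} x t \<in> N" if "t \<ge> 0" for t
      using segment_in_C1_ball[OF path p _ near that, of k] x0 \<phi>b sub ball V(3) by blast
    have inUd: "restr d (segment {..0} x t) \<in> Ud" if "t \<ge> 0" for t
      using y \<psi>X(2) xy that unfolding reduced.ivp_solution_iff restr_segment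
      by (cases "t = 0") auto
    have "solution_on {..0} U f {0..} x"
      unfolding solution_on_half_line_iff
    proof (intro allI impI conjI)
      fix t :: real assume t: "t \<ge> 0"
      show "segment {..0} x t \<in> U" using inN[OF t] N_subset by blast
      have "x' t = f (segment {..0} x t)"
        using x' xy t f_extend_restr[OF inN[OF t] inUd[OF t]] by (simp add: restr_segment)
      then show "(x has_vector_derivative f (segment {..0} x t)) (at t)" using xd[OF t] by simp
    qed
    then show "\<exists>x. solution_on {..0} U f {0..} x \<and> segment {..0} x 0 = \<phi> \<and>
      (\<forall>t\<ge>0. norm (x t - q) + norm (vector_derivative x (at t))
        \<le> c * exp (-\<gamma> * t) * norm_d1 d (restr d \<phi> - restr d p))"
      using x0 bound vector_derivative_at[OF xd] unfolding \<psi>_def by (intro exI[of _ x]) simp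
  qed
qed

lemma ivp_solution_half_line:
  "solution_on {..0} U f {0..} x \<Longrightarrow> ivp_solution {..0} U f (segment {..0} x 0) \<infinity> x"
  unfolding solution_on_half_line_iff full.ivp_solution_iff by simp

text \<open>Started close to p and decaying, the solution never leaves \<open>W\<close>, so its
  restriction is an orbit of the reduced semiflow. The weighted bound \<open>b\<close> is the form
  in which (II) recognises points of the stable manifold.\<close>

lemma exponential_decay_restr:
  assumes V: "openin (C1_top {..0}) V" "p \<in> V" "V \<subseteq> N" and p: "\<forall>s\<le>0. p s = q" "restr d p \<in> Ud"
    and \<beta>: "\<beta> > 0" and b: "b > 0"
  shows "\<exists>Vh c. openin (C1_top {..0}) Vh \<and> p \<in> Vh \<and> Vh \<subseteq> V \<and> c > 0 \<and>
    (\<forall>x. solution_on {..0} U f {0..} x \<and> segment {..0} x 0 \<in> Vh \<inter> solution_manifold {..0} U f \<and>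
      (\<forall>t\<ge>0. norm (x t - q) + norm (vector_derivative x (at t)) \<le> c * exp (-\<beta> * t)) \<longrightarrow>
      restr d (segment {..0} x 0) \<in> solution_manifold {-d..0} Ud (\<lambda>\<phi>. f (extend d \<phi>)) \<and>
      (\<forall>t\<ge>0. (t, restr d (segment {..0} x 0)) \<in> semiflow_domain {-d..0} Ud (\<lambda>\<phi>. f (extend d \<phi>)) \<and>
         exp (\<beta> * t) * norm_d1 d (semiflow {-d..0} Ud (\<lambda>\<phi>. f (extend d \<phi>)) t
           (restr d (segment {..0} x 0)) - restr d p) < b))"
proof -
  let ?fd = "\<lambda>\<phi>. f (extend d \<phi>)"
  define W where "W = V \<inter> {\<phi> \<in> C1 {..0}. restr d \<phi> \<in> Ud}"
  have V_C1: "V \<subseteq> C1 {..0}" using V N_subset full.U_subset by blast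
  then have p1: "p \<in> C1 {..0}" using V by blast
  have W: "openin (C1_top {..0}) W" "p \<in> W"
    unfolding W_def using V(2) p(2) p1 by (auto intro!: openin_Int V openin_restr_vimage[OF d] Ud_open)
  obtain k \<epsilon> where k: "k \<ge> d" and \<epsilon>: "\<epsilon> > 0" and ball: "C1_ball {..0} {-k..0} \<epsilon> p \<subseteq> W"
    using openin_C1_half_lineE[OF W] .
  \<comment> \<open>At times u \<ge> t - d the bound exp (-\<beta> * u) is at most exp (\<beta> * d)
    * exp (-\<beta> * t), and values and derivatives count separately; the choice gives 2 * \<delta>
    * exp (\<beta> * d) \<le> b / 2.\<close>
  define \<delta> where "\<delta> = min \<epsilon> (b / (4 * exp (\<beta> * d)))"
  have \<delta>: "\<delta> > 0" "\<delta> \<le> \<epsilon>" using \<epsilon> b by (auto simp: \<delta>_def)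
  have "\<delta> \<le> b / (4 * exp (\<beta> * d))" by (simp add: \<delta>_def)
  then have b\<delta>: "2 * \<delta> * exp (\<beta> * d) < b" using b by (simp add: field_simps)
  define Vh where "Vh = C1_ball {..0} {-k..0} \<delta> p"
  have Vh: "Vh \<subseteq> W" using \<delta>(2) ball by (force simp: Vh_def C1_ball_def)
  show ?thesis
  \<comment> \<open>Half of \<delta> as the constant yields the strict inequality that the ball asks
    for, already at t = 0.\<close>
  proof (rule exI[of _ Vh], rule exI[of _ "\<delta> / 2"], intro conjI allI impI; (elim conjE)?)
    show "openin (C1_top {..0}) Vh" unfolding Vh_def by (intro openin_C1_ball p1) auto
    show "p \<in> Vh" unfolding Vh_def by (rule centre_in_C1_ball[OF p1 \<delta>(1)])
    show "Vh \<subseteq> V" using Vh by (auto simp: W_def)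
    show "\<delta> / 2 > 0" using \<delta> by simp
    fix x
    assume sol: "solution_on {..0} U f {0..} x"
      and init: "segment {..0} x 0 \<in> Vh \<inter> solution_manifold {..0} U f"
      and decay: "\<forall>t\<ge>0. norm (x t - q) + norm (vector_derivative x (at t)) \<le> \<delta> / 2 * exp (-\<beta> * t)"
    define \<phi> where "\<phi> = segment {..0} x 0"
    have \<phi>: "\<phi> \<in> Vh" "\<phi> \<in> W" "\<phi> \<in> C1 {..0}" using init Vh V_C1 by (auto simp: \<phi>_def W_def)
    have ivp: "ivp_solution {..0} U f \<phi> \<infinity> x"
      using ivp_solution_half_line[OF sol] by (simp add: \<phi>_def)
    obtain x' where path: "C1_path {..0} \<infinity> x x'"
      and "\<forall>t. 0 < t \<and> ereal t < \<infinity> \<longrightarrow> x' t = f (segment {..0} x t)"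
      and x'0: "\<forall>s\<in>{..0}. x' s = hderiv {..0} \<phi> s"
      using full.ivp_solution_C1_path[OF ivp \<phi>(3) full.U_subset] .
    have xd: "norm (x t - q) + norm (x' t) \<le> \<delta> / 2 * exp (-\<beta> * t)" if "t \<ge> 0" for t
      using vector_derivative_at[OF full.C1_path_at[OF path that]] spec[OF decay, of t] that by simp
    have near: "norm (x t - q) < \<delta> \<and> norm (x' t) < \<delta>" if t: "t \<ge> 0" for t
    proof -
      have "\<delta> / 2 * exp (-\<beta> * t) \<le> \<delta> / 2 * 1"
        using \<delta>(1) \<beta> t by (intro mult_left_mono) auto
      then show ?thesis using xd[OF t] \<delta>(1) norm_ge_zero[of "x t - q"] norm_ge_zero[of "x' t"]
        by linarith
    qed
    have inW: "segment {..0} x t \<in> W" if "t \<ge> 0" for t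
      using segment_in_C1_ball[OF path p(1) _ near that, of k] \<phi>(1) Vh unfolding Vh_def \<phi>_def by blast
    then have inN: "segment {..0} x t \<in> N" and inUd: "restr d (segment {..0} x t) \<in> Ud" if "t \<ge> 0" for t
      using V(3) that by (auto simp: W_def)
    have y: "ivp_solution {-d..0} Ud ?fd (restr d \<phi>) \<infinity> x"
      using ivp by (rule ivp_solution_restr) (auto intro: inN inUd)
    have \<phi>X: "restr d \<phi> \<in> solution_manifold {-d..0} Ud ?fd"
      using restr_solution_manifold_iff[of \<phi>] inN[of 0] inUd[of 0] init by (simp add: \<phi>_def)
    then show "restr d (segment {..0} x 0) \<in> solution_manifold {-d..0} Ud ?fd" by (simp add: \<phi>_def)
    fix t :: real assume t: "t \<ge> 0"
    show "(t, restr d (segment {..0} x 0)) \<in> semiflow_domain {-d..0} Ud ?fd"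
      using \<phi>X t reduced.ivp_solution_less_t_max[OF y, of t]
      by (simp add: semiflow_domain_def \<phi>_def)
    have flow: "semiflow {-d..0} Ud ?fd t (restr d \<phi>) = restr d (segment {..0} x t)"
      using reduced.semiflow_eq[OF _ y t] inUd[of 0] by (simp add: restr_segment \<phi>_def)
    have "norm_d1 d (restr d (segment {..0} x t) - restr d p) \<le> 2 * (\<delta> * exp (-\<beta> * (t - d)))"
    proof (rule norm_d1_restr_segment_le[OF path p1 p(1) d t])
      fix u assume u: "t - d \<le> u" "u \<le> t"
      show "norm (x u - q) \<le> \<delta> * exp (-\<beta> * (t - d)) \<and> norm (x' u) \<le> \<delta> * exp (-\<beta> * (t - d))"
      proof (cases "u \<ge> 0")
        case True
        have "-\<beta> * u \<le> -\<beta> * (t - d)" using u \<beta> by simp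
        then have "\<delta> / 2 * exp (-\<beta> * u) \<le> \<delta> * exp (-\<beta> * (t - d))"
          using \<delta>(1) by (intro mult_mono) auto
        then show ?thesis using xd[OF True] norm_ge_zero[of "x u - q"] norm_ge_zero[of "x' u"]
          by linarith
      next
        \<comment> \<open>Negative times belong to the initial history, which is within \<delta> of
          p because k \<ge> d. The claimed bound is at least \<delta> here, since t - d \<le> u <
          0.\<close>
        case False
        then have uk: "u \<in> {-k..0}" using u t k by auto
        have "norm (\<phi> u - p u) < \<delta>" "norm (hderiv {..0} \<phi> u - hderiv {..0} p u) < \<delta>"
          using \<phi>(1) uk by (auto simp: Vh_def C1_ball_def)
        then have "norm (x u - q) < \<delta>" "norm (x' u) < \<delta>"
          using False p(1) constant_hderiv[OF p(1), of u] x'0 by (simp_all add: \<phi>_def segment_def)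
        moreover have "\<delta> * 1 \<le> \<delta> * exp (-\<beta> * (t - d))"
          using \<delta>(1) \<beta> u False by (intro mult_left_mono) (auto simp: mult_le_0_iff)
        ultimately show ?thesis by simp
      qed
    qed
    then have "exp (\<beta> * t) * norm_d1 d (restr d (segment {..0} x t) - restr d p)
        \<le> exp (\<beta> * t) * (2 * (\<delta> * exp (-\<beta> * (t - d))))"
      by (intro mult_left_mono) auto
    also have "\<dots> = 2 * \<delta> * (exp (\<beta> * t) * exp (-\<beta> * (t - d)))" by simp
    also have "exp (\<beta> * t) * exp (-\<beta> * (t - d)) = exp (\<beta> * d)"
      by (simp add: algebra_simps flip: exp_add)
    finally show "exp (\<beta> * t) * norm_d1 d (semiflow {-d..0} Ud ?fd t
        (restr d (segment {..0} x 0)) - restr d p) < b"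
      using b\<delta> unfolding flow[unfolded \<phi>_def] by (rule le_less_trans)
  qed
qed

end

section \<open>Parts (i) to (iii) from the known properties of the reduced stable manifold\<close>

theorem proposition15p1:
  fixes U N V Ud Wsd Cs Cc Cu :: "(real \<Rightarrow> real^'n) set"
    and X Xd Ws :: "(real \<Rightarrow> real^'n) set"
    and f fd :: "(real \<Rightarrow> real^'n) \<Rightarrow> real^'n"
    and De_fd :: "(real \<Rightarrow> real^'n) \<Rightarrow> (real \<Rightarrow> real^'n) \<Rightarrow> real^'n"
    and \<phi>b \<phi>bd :: "real \<Rightarrow> real^'n"
    and \<Omega> \<Omega>d :: "(real \<times> (real \<Rightarrow> real^'n)) set"
    and \<Sigma> \<Sigma>d :: "real \<Rightarrow> (real \<Rightarrow> real^'n) \<Rightarrow> real \<Rightarrow> real^'n"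
    and A :: "((real \<Rightarrow> real^'n) \<times> (real \<Rightarrow> real^'n)) set"
    and d \<beta> \<gamma> :: real
  defines "X \<equiv> solution_manifold {..0} U f"
    and "\<Omega> \<equiv> semiflow_domain {..0} U f"
    and "\<Sigma> \<equiv> semiflow {..0} U f"
    and "\<phi>bd \<equiv> restr d \<phi>b"
    and "fd \<equiv> (\<lambda>\<phi>. f (extend d \<phi>))"
    and "Xd \<equiv> solution_manifold {-d..0} Ud fd"
    and "\<Omega>d \<equiv> semiflow_domain {-d..0} Ud fd"
    and "\<Sigma>d \<equiv> semiflow {-d..0} Ud fd"
    and "A \<equiv> generator (Cont_top {-d..0}) (linear_semigroup d (De_fd \<phi>bd))"
    and "Ws \<equiv> {\<phi> \<in> V. restr d \<phi> \<in> Wsd}"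
  assumes U_open: "openin (C1_top {..0}) U"
    and f_C1F: "C1F_smooth (C1_top {..0}) euclidean U f"
    and f_e: "property_e {..0} U f"
    and stat: "\<phi>b \<in> X" "stationary_point \<Omega> \<Sigma> \<phi>b"
    and N: "openin (C1_top {..0}) N" "\<phi>b \<in> N" "N \<subseteq> U"
    and d: "d > 0" "\<forall>\<xi>\<in>N. \<forall>\<psi>\<in>N. (\<forall>s\<in>{-d..0}. \<xi> s = \<psi> s) \<longrightarrow> f \<xi> = f \<psi>"
    and Ud: "openin (C1_top {-d..0}) Ud" "\<phi>bd \<in> Ud" "extend d ` Ud \<subseteq> N"
    and De_fd: "extended_derivative {-d..0} Ud fd De_fd"
    and decomp: "spectral_decomposition (Cont_top {-d..0}) A Cs Cc Cu"
    and Wsd: "C1F_submanifold (C1_top {-d..0}) Wsd (CARD('n) + dim Cc + dim Cu)"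
      "Wsd \<subseteq> Xd" "\<phi>bd \<in> Wsd"
      "locally_positively_invariant (C1_top {-d..0}) \<Omega>d \<Sigma>d \<phi>bd Wsd"
      "tangent_space (C1_top {-d..0}) Wsd \<phi>bd = Cs \<inter> tangent_space (C1_top {-d..0}) Xd \<phi>bd"
    and \<beta>: "\<beta> > 0" "\<forall>z\<in>op_spectrum (Cont_top {-d..0}) A. Re z < 0 \<longrightarrow> Re z < -\<beta>"
    and \<gamma>: "\<gamma> > \<beta>"
    and Wsd_I: "\<exists>Wt c. openin (subtopology (C1_top {-d..0}) Wsd) Wt \<and> \<phi>bd \<in> Wt \<and> c > 0 \<and>
        (\<forall>\<psi>\<in>Wt. \<forall>t\<ge>0. (t, \<psi>) \<in> \<Omega>d \<and> \<Sigma>d t \<psi> \<in> Wsd \<and>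
           norm_d1 d (\<Sigma>d t \<psi> - \<phi>bd) \<le> c * exp (-\<gamma> * t) * norm_d1 d (\<psi> - \<phi>bd))"
    and Wsd_II: "\<exists>cb>0. \<forall>\<psi>\<in>Xd.
        (\<forall>t\<ge>0. (t, \<psi>) \<in> \<Omega>d \<and> exp (\<beta> * t) * norm_d1 d (\<Sigma>d t \<psi> - \<phi>bd) < cb) \<longrightarrow> \<psi> \<in> Wsd"
    and V: "openin (C1_top {..0}) V" "\<phi>b \<in> V" "V \<subseteq> N"
    and Ws: "C1F_submanifold (C1_top {..0}) Ws (CARD('n) + dim Cc + dim Cu)"
      "tangent_space (C1_top {..0}) Ws \<phi>b =
         {\<xi> \<in> C1 {..0}. restr d \<xi> \<in> Cs \<inter> tangent_space (C1_top {-d..0}) Xd \<phi>bd}"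
  shows "(Ws \<subseteq> X \<and> locally_positively_invariant (C1_top {..0}) \<Omega> \<Sigma> \<phi>b Ws)
    \<and> (\<exists>Vt ct. openin (C1_top {..0}) Vt \<and> \<phi>b \<in> Vt \<and> Vt \<subseteq> V \<and> {0..} \<times> (Vt \<inter> Ws) \<subseteq> \<Omega> \<and> ct > 0 \<and>
        (\<forall>\<phi>\<in>Vt \<inter> Ws. (\<exists>!x. solution_on {..0} U f {0..} x \<and> segment {..0} x 0 = \<phi>) \<and>
           (\<forall>x. solution_on {..0} U f {0..} x \<and> segment {..0} x 0 = \<phi> \<longrightarrow>
              (\<forall>t\<ge>0. norm (x t - \<phi>b 0) + norm (vector_derivative x (at t))
                 \<le> ct * exp (-\<gamma> * t) * norm_d1 d (restr d \<phi> - \<phi>bd)))))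
    \<and> (\<exists>Vh ch. openin (C1_top {..0}) Vh \<and> \<phi>b \<in> Vh \<and> Vh \<subseteq> V \<and> ch > 0 \<and>
        (\<forall>x. solution_on {..0} U f {0..} x \<and> segment {..0} x 0 \<in> Vh \<inter> X \<and>
           (\<forall>t\<ge>0. norm (x t - \<phi>b 0) + norm (vector_derivative x (at t)) \<le> ch * exp (-\<beta> * t))
           \<longrightarrow> segment {..0} x 0 \<in> Ws))"
proof -
  obtain De where De: "extended_derivative {..0} U f De"
    using f_e unfolding property_e_def by blast
  interpret delay_reduction U N Ud f De De_fd d
    by (rule delay_reduction.intro[OF U_open De N(3) d Ud(1,3) De_fd[unfolded fd_def]])
  note unfolds = X_def \<Omega>_def \<Sigma>_def Xd_def \<Omega>d_def \<Sigma>d_def fd_def \<phi>bd_def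
  have const: "\<forall>s\<le>0. \<phi>b s = \<phi>b 0"
    using stationary_point_constant[OF stat(2)[unfolded unfolds]] by blast
  have WsdUd: "Wsd \<subseteq> Ud" using Wsd(2) by (auto simp: Xd_def solution_manifold_def)
  have WsX: "Ws \<subseteq> X"
    using restr_solution_manifold_iff Wsd(2) WsdUd V(3) unfolding Ws_def unfolds by blast
  have inv: "locally_positively_invariant (C1_top {..0}) \<Omega> \<Sigma> \<phi>b Ws"
    unfolding Ws_def \<Omega>_def \<Sigma>_def
    by (rule locally_positively_invariant_lift[OF V Wsd(2,3,4)[unfolded unfolds]])
  have "\<gamma> > 0" using \<beta>(1) \<gamma> by simp
  obtain Wt c where Wt: "openin (subtopology (C1_top {-d..0}) Wsd) Wt" "\<phi>bd \<in> Wt" and c: "c > 0"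
    and decay: "\<forall>\<psi>\<in>Wt. \<forall>t\<ge>0. (t, \<psi>) \<in> \<Omega>d \<and>
      norm_d1 d (\<Sigma>d t \<psi> - \<phi>bd) \<le> c * exp (-\<gamma> * t) * norm_d1 d (\<psi> - \<phi>bd)"
    using Wsd_I by blast
  obtain Vt where Vt: "openin (C1_top {..0}) Vt" "\<phi>b \<in> Vt" "Vt \<subseteq> V"
    and solutions: "\<forall>\<phi>\<in>Vt. restr d \<phi> \<in> Wsd \<longrightarrow>
      (\<exists>x. solution_on {..0} U f {0..} x \<and> segment {..0} x 0 = \<phi> \<and>
      (\<forall>t\<ge>0. norm (x t - \<phi>b 0) + norm (vector_derivative x (at t))
        \<le> c * exp (-\<gamma> * t) * norm_d1 d (restr d \<phi> - \<phi>bd)))"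
    using exponential_decay_lift[OF V const Wsd(2)[unfolded unfolds] Wt[unfolded \<phi>bd_def] c \<open>\<gamma> > 0\<close>
        decay[unfolded unfolds]] unfolding \<phi>bd_def by blast
  have stable: "(t, \<phi>) \<in> \<Omega>"
      "(\<exists>!x. solution_on {..0} U f {0..} x \<and> segment {..0} x 0 = \<phi>) \<and>
       (\<forall>x. solution_on {..0} U f {0..} x \<and> segment {..0} x 0 = \<phi> \<longrightarrow>
          (\<forall>t\<ge>0. norm (x t - \<phi>b 0) + norm (vector_derivative x (at t))
             \<le> c * exp (-\<gamma> * t) * norm_d1 d (restr d \<phi> - \<phi>bd)))"
    if \<phi>: "\<phi> \<in> Vt \<inter> Ws" "t \<ge> 0" for \<phi> t
  proof -
    have \<phi>X: "\<phi> \<in> X" "\<phi> \<in> U" using \<phi> WsX by (auto simp: X_def solution_manifold_def)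
    obtain x where x: "solution_on {..0} U f {0..} x" "segment {..0} x 0 = \<phi>"
      "\<forall>t\<ge>0. norm (x t - \<phi>b 0) + norm (vector_derivative x (at t))
        \<le> c * exp (-\<gamma> * t) * norm_d1 d (restr d \<phi> - \<phi>bd)"
      using solutions \<phi>(1) unfolding Ws_def by blast
    have ivp: "ivp_solution {..0} U f \<phi> \<infinity> z"
      if "solution_on {..0} U f {0..} z" "segment {..0} z 0 = \<phi>" for z
      using ivp_solution_half_line that by blast
    \<comment> \<open>A solution on [0,\<infinity>) together with its history is defined on the
      whole line, so uniqueness is equality of functions and the estimate for x holds for every
      solution.\<close>
    have unique: "z = x" if "solution_on {..0} U f {0..} z" "segment {..0} z 0 = \<phi>" for z
      using full.ivp_solution_unique[OF \<phi>X(2) ivp[OF that] ivp[OF x(1,2)]] by (intro ext) simp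
    show "(t, \<phi>) \<in> \<Omega>"
      using \<phi>X(1) \<phi>(2) full.ivp_solution_less_t_max[OF ivp[OF x(1,2)], of t]
      by (simp add: \<Omega>_def X_def semiflow_domain_def)
    show "(\<exists>!x. solution_on {..0} U f {0..} x \<and> segment {..0} x 0 = \<phi>) \<and>
       (\<forall>x. solution_on {..0} U f {0..} x \<and> segment {..0} x 0 = \<phi> \<longrightarrow>
          (\<forall>t\<ge>0. norm (x t - \<phi>b 0) + norm (vector_derivative x (at t))
             \<le> c * exp (-\<gamma> * t) * norm_d1 d (restr d \<phi> - \<phi>bd)))"
      using x unique by metis
  qed
  obtain cb where cb: "cb > 0" and Wsd_mem: "\<forall>\<psi>\<in>Xd.
      (\<forall>t\<ge>0. (t, \<psi>) \<in> \<Omega>d \<and> exp (\<beta> * t) * norm_d1 d (\<Sigma>d t \<psi> - \<phi>bd) < cb) \<longrightarrow> \<psi> \<in> Wsd"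
    using Wsd_II by blast
  \<comment> \<open>The threshold \<open>cb\<close> of (II) is passed on as the bound
    \<open>b\<close>, which places the restricted initial history in \<open>Wsd\<close>.\<close>
  obtain Vh ch where Vh: "openin (C1_top {..0}) Vh" "\<phi>b \<in> Vh" "Vh \<subseteq> V" "ch > 0"
    and converse: "\<forall>x. solution_on {..0} U f {0..} x \<and> segment {..0} x 0 \<in> Vh \<inter> X \<and>
      (\<forall>t\<ge>0. norm (x t - \<phi>b 0) + norm (vector_derivative x (at t)) \<le> ch * exp (-\<beta> * t)) \<longrightarrow>
      restr d (segment {..0} x 0) \<in> Xd \<and>
      (\<forall>t\<ge>0. (t, restr d (segment {..0} x 0)) \<in> \<Omega>d \<and>
         exp (\<beta> * t) * norm_d1 d (\<Sigma>d t (restr d (segment {..0} x 0)) - \<phi>bd) < cb)"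
    using exponential_decay_restr[OF V const Ud(2)[unfolded \<phi>bd_def] \<beta>(1) cb]
    unfolding unfolds by blast
  show ?thesis
  proof (intro conjI)
    show "Ws \<subseteq> X" by (fact WsX)
    show "locally_positively_invariant (C1_top {..0}) \<Omega> \<Sigma> \<phi>b Ws" by (fact inv)
    show "\<exists>Vt ct. openin (C1_top {..0}) Vt \<and> \<phi>b \<in> Vt \<and> Vt \<subseteq> V \<and> {0..} \<times> (Vt \<inter> Ws) \<subseteq> \<Omega> \<and> ct > 0 \<and>
        (\<forall>\<phi>\<in>Vt \<inter> Ws. (\<exists>!x. solution_on {..0} U f {0..} x \<and> segment {..0} x 0 = \<phi>) \<and>
           (\<forall>x. solution_on {..0} U f {0..} x \<and> segment {..0} x 0 = \<phi> \<longrightarrow>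
              (\<forall>t\<ge>0. norm (x t - \<phi>b 0) + norm (vector_derivative x (at t))
                 \<le> ct * exp (-\<gamma> * t) * norm_d1 d (restr d \<phi> - \<phi>bd))))"
      using stable(1) stable(2)[OF _ order_refl]
      by (intro exI[of _ Vt] exI[of _ c] conjI Vt c ballI subsetI) auto
    show "\<exists>Vh ch. openin (C1_top {..0}) Vh \<and> \<phi>b \<in> Vh \<and> Vh \<subseteq> V \<and> ch > 0 \<and>
        (\<forall>x. solution_on {..0} U f {0..} x \<and> segment {..0} x 0 \<in> Vh \<inter> X \<and>
           (\<forall>t\<ge>0. norm (x t - \<phi>b 0) + norm (vector_derivative x (at t)) \<le> ch * exp (-\<beta> * t))
           \<longrightarrow> segment {..0} x 0 \<in> Ws)"
    proof (intro exI[of _ Vh] exI[of _ ch] conjI Vh allI impI)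
      fix x assume x: "solution_on {..0} U f {0..} x \<and> segment {..0} x 0 \<in> Vh \<inter> X \<and>
         (\<forall>t\<ge>0. norm (x t - \<phi>b 0) + norm (vector_derivative x (at t)) \<le> ch * exp (-\<beta> * t))"
      then have "restr d (segment {..0} x 0) \<in> Wsd" using converse Wsd_mem by blast
      then show "segment {..0} x 0 \<in> Ws" using x Vh(3) by (auto simp: Ws_def)
    qed
  qed
qed

end
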